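(* Let $f\colon X\to Y$ be a continuous closed surjection, where $X$ is a $k$-space and $Y$ is a paracompact $C$-space. Let $K$ be a space such that, for every $m\in\mathbb{N}$ and every $y\in Y$, both $K\in ANE(\mathbb{I}^m\times X)$ and $K\in AE(\mathbb{I}^m\times f^{-1}(y))$ hold. Then $K\in AE(X)$.
   Context: All spaces are completely regular and all single-valued maps are continuous. $\mathbb{I}=[0,1]$. For spaces $K$ and $X$: $K\in AE(X)$ (respectively $K\in ANE(X)$) means that every continuous map $A\to K$ defined on a closed subset $A\subset X$ extends continuously to a map $X\to K$ (respectively to a map from some neighborhood of $A$ in $X$ into $K$). A space $Y$ is a $C$-space if for every sequence $\{\omega_n\}_{n\in\mathbb{N}}$ of open covers of $Y$ there is a sequence $\{\gamma_n\}_{n\in\mathbb{N}}$ of families of pairwise disjoint open subsets of $Y$ such that each $\gamma_n$ refines $\omega_n$ (every member of $\gamma_n$ lies in some member of $\omega_n$) and $\bigcup_n\gamma_n$ covers $Y$. *)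

theory Defs
  imports "HOL-Analysis.Analysis"
begin

text \<open>
  Completely regular spaces are understood to include the \<open>T\<^sub>1\<close> axiom (hence to be Hausdorff),
  whereas the library's \<^const>\<open>completely_regular_space\<close> is free of separation axioms.
\<close>

definition tychonoff_space :: "'a topology \<Rightarrow> bool" where
  "tychonoff_space X \<longleftrightarrow> completely_regular_space X \<and> t1_space X"

definition open_cover_of :: "'a topology \<Rightarrow> 'a set set \<Rightarrow> bool" where
  "open_cover_of X \<U> \<longleftrightarrow> (\<forall>U\<in>\<U>. openin X U) \<and> \<Union>\<U> = topspace X"

definition refines :: "'a set set \<Rightarrow> 'a set set \<Rightarrow> bool" where
  "refines \<V> \<U> \<longleftrightarrow> (\<forall>V\<in>\<V>. \<exists>U\<in>\<U>. V \<subseteq> U)"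

definition paracompact_space :: "'a topology \<Rightarrow> bool" where
  "paracompact_space X \<longleftrightarrow>
     (\<forall>\<U>. open_cover_of X \<U> \<longrightarrow>
        (\<exists>\<V>. open_cover_of X \<V> \<and> refines \<V> \<U> \<and> locally_finite_in X \<V>))"

definition C_space :: "'a topology \<Rightarrow> bool" where
  "C_space Y \<longleftrightarrow>
     (\<forall>\<omega> :: nat \<Rightarrow> 'a set set. (\<forall>n. open_cover_of Y (\<omega> n)) \<longrightarrow>
        (\<exists>\<gamma> :: nat \<Rightarrow> 'a set set.
           (\<forall>n. (\<forall>U\<in>\<gamma> n. openin Y U) \<and> pairwise disjnt (\<gamma> n) \<and> refines (\<gamma> n) (\<omega> n)) \<and>
           topspace Y \<subseteq> (\<Union>n. \<Union>(\<gamma> n))))"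

text \<open>\<open>in_AE K X\<close> and \<open>in_ANE K X\<close> stand for \<open>K \<in> AE(X)\<close> and \<open>K \<in> ANE(X)\<close>.\<close>

definition in_AE :: "'k topology \<Rightarrow> 'a topology \<Rightarrow> bool" where
  "in_AE K X \<longleftrightarrow>
     (\<forall>A g. closedin X A \<and> continuous_map (subtopology X A) K g \<longrightarrow>
        (\<exists>h. continuous_map X K h \<and> (\<forall>x\<in>A. h x = g x)))"

definition in_ANE :: "'k topology \<Rightarrow> 'a topology \<Rightarrow> bool" where
  "in_ANE K X \<longleftrightarrow>
     (\<forall>A g. closedin X A \<and> continuous_map (subtopology X A) K g \<longrightarrow>
        (\<exists>U h. openin X U \<and> A \<subseteq> U \<and> continuous_map (subtopology X U) K h \<and>
               (\<forall>x\<in>A. h x = g x)))"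

definition cube :: "nat \<Rightarrow> (nat \<Rightarrow> real) topology" where
  "cube m = product_topology (\<lambda>_. top_of_set {0..1}) {..<m}"

end

theory Submission
  imports Defs
begin

text \<open>
  Fix a closed set \<open>A\<close> and a map \<open>g\<close> on it. Over a small open set of \<open>Y\<close> any partial family of
  extensions of \<open>g\<close>, parametrised by a closed subset of a finite cube, extends to the whole cube:
  over a single fibre by the \<open>AE\<close> hypothesis, then to a neighbourhood by the \<open>ANE\<close> hypothesis, and
  this neighbourhood contains the preimage of an open set because \<open>f\<close> is closed and cubes are compact.
  Using this countably often one obtains locally finite open covers \<open>\<omega> n\<close> of \<open>Y\<close> together with
  one compatible family \<open>H t\<close> of local extensions, where \<open>t\<close> runs through the points of the nerve
  having at most one vertex from each \<open>\<omega> n\<close>. The \<open>C\<close>-space property supplies disjoint refinements of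
  the \<open>\<omega> n\<close>, hence a map \<open>t\<close> from \<open>Y\<close> to the nerve that respects this restriction, and
  \<open>x \<mapsto> H (t (f x)) x\<close> is the extension.
\<close>

subsection \<open>Extension properties and cubes\<close>

lemma in_AE_E:
  assumes "in_AE K X" "closedin X A" "continuous_map (subtopology X A) K g"
  obtains h where "continuous_map X K h" "\<forall>x\<in>A. h x = g x"
  using assms unfolding in_AE_def by blast

lemma in_ANE_E:
  assumes "in_ANE K X" "closedin X A" "continuous_map (subtopology X A) K g"
  obtains U h where "openin X U" "A \<subseteq> U" "continuous_map (subtopology X U) K h"
    "\<forall>x\<in>A. h x = g x"
proof -
  have "\<exists>U h. openin X U \<and> A \<subseteq> U \<and> continuous_map (subtopology X U) K h \<and> (\<forall>x\<in>A. h x = g x)"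
    using assms(1)[unfolded in_ANE_def, rule_format, OF conjI[OF assms(2,3)]] .
  then show ?thesis using that by auto
qed

text \<open>Extend \<open>g \<circ> q\<close> from the preimage of \<open>A\<close> under
  \<open>q\<close>, then compose with \<open>p\<close>; \<open>q (p z) = z\<close> restores
  \<open>g\<close> on \<open>A\<close>.\<close>

lemma in_AE_retract:
  assumes p: "continuous_map Z Z' p" and q: "continuous_map Z' Z q"
    and qp: "\<And>z. z \<in> topspace Z \<Longrightarrow> q (p z) = z" and "in_AE K Z'"
  shows "in_AE K Z"
  unfolding in_AE_def
proof (intro allI impI, elim conjE)
  fix A g assume A: "closedin Z A" and g: "continuous_map (subtopology Z A) K g"
  let ?A = "{z \<in> topspace Z'. q z \<in> A}"
  have "closedin Z' ?A" using closedin_continuous_map_preimage[OF q A] .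
  moreover have "continuous_map (subtopology Z' ?A) K (g \<circ> q)"
    by (rule continuous_map_compose[OF _ g])
      (auto simp: continuous_map_in_subtopology continuous_map_from_subtopology[OF q])
  ultimately obtain h where h: "continuous_map Z' K h" "\<forall>x\<in>?A. h x = (g \<circ> q) x"
    by (rule in_AE_E[OF \<open>in_AE K Z'\<close>]) (rule that)
  have "\<forall>x\<in>A. (h \<circ> p) x = g x"
    using h(2) closedin_subset[OF A] qp continuous_map_image_subset_topspace[OF p] by fastforce
  then show "\<exists>h. continuous_map Z K h \<and> (\<forall>x\<in>A. h x = g x)"
    using continuous_map_compose[OF p h(1)] by blast
qed

text \<open>As for \<open>in_AE\<close>, with the neighbourhood in \<open>Z'\<close> pulled back
  along \<open>p\<close>.\<close>

lemma in_ANE_retract: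
  assumes p: "continuous_map Z Z' p" and q: "continuous_map Z' Z q"
    and qp: "\<And>z. z \<in> topspace Z \<Longrightarrow> q (p z) = z" and "in_ANE K Z'"
  shows "in_ANE K Z"
  unfolding in_ANE_def
proof (intro allI impI, elim conjE)
  fix A g assume A: "closedin Z A" and g: "continuous_map (subtopology Z A) K g"
  let ?A = "{z \<in> topspace Z'. q z \<in> A}"
  have "closedin Z' ?A" using closedin_continuous_map_preimage[OF q A] .
  moreover have "continuous_map (subtopology Z' ?A) K (g \<circ> q)"
    by (rule continuous_map_compose[OF _ g])
      (auto simp: continuous_map_in_subtopology continuous_map_from_subtopology[OF q])
  ultimately obtain U h where U: "openin Z' U" "?A \<subseteq> U"
    and h: "continuous_map (subtopology Z' U) K h" "\<forall>x\<in>?A. h x = (g \<circ> q) x"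
    by (rule in_ANE_E[OF \<open>in_ANE K Z'\<close>]) (rule that)
  let ?U = "{z \<in> topspace Z. p z \<in> U}"
  have pA: "p x \<in> ?A" if "x \<in> A" for x
    using that closedin_subset[OF A] qp continuous_map_image_subset_topspace[OF p] by fastforce
  have "\<forall>x\<in>A. (h \<circ> p) x = g x"
    using h(2) pA closedin_subset[OF A] qp by fastforce
  moreover have "A \<subseteq> ?U" using pA U closedin_subset[OF A] by blast
  moreover have "openin Z ?U" using openin_continuous_map_preimage[OF p U(1)] .
  moreover have "continuous_map (subtopology Z ?U) K (h \<circ> p)"
    by (rule continuous_map_compose[OF _ h(1)])
      (auto simp: continuous_map_in_subtopology continuous_map_from_subtopology[OF p])
  ultimately show "\<exists>U h. openin Z U \<and> A \<subseteq> U \<and> continuous_map (subtopology Z U) K h \<and> (\<forall>x\<in>A. h x = g x)"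
    by blast
qed

text \<open>All cubes live in the one space \<open>'j \<Rightarrow> real\<close>, padded by zeros
  off \<open>F\<close>. Faces are then literal subsets, so families over different \<open>F\<close>
  can be compared without transition maps.\<close>

definition cube_on :: "'j set \<Rightarrow> ('j \<Rightarrow> real) set" where
  "cube_on F = {t. \<forall>j. t j \<in> (if j \<in> F then {0..1} else {0})}"

lemma cube_on_eq_PiE: "cube_on F = (\<Pi>\<^sub>E j\<in>UNIV. if j \<in> F then {0..1} else {0})"
  unfolding cube_on_def PiE_UNIV_domain Pi_def by simp

lemma cube_on_mono: "F \<subseteq> G \<Longrightarrow> cube_on F \<subseteq> cube_on G"
  by (auto simp: cube_on_def subset_iff split: if_splits) (metis less_eq_real_def zero_le_one)+

lemma compact_space_cube_on: "compact_space (subtopology (powertop_real UNIV) (cube_on F))"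
proof -
  have "compactin (powertop_real UNIV) (cube_on F)"
    unfolding cube_on_eq_PiE compactin_PiE by auto
  then show ?thesis by (rule compact_space_subtopology)
qed

abbreviation param_prod :: "'a topology \<Rightarrow> (('j \<Rightarrow> real) \<times> 'a) topology" where
  "param_prod X \<equiv> prod_topology (powertop_real UNIV) X"

text \<open>Enumerating \<open>F\<close> identifies \<open>cube_on F\<close> with a face of a
  standard cube. This carries extension properties known for \<open>cube m\<close> over to
  \<open>cube_on F\<close>.\<close>

lemma cube_on_retract_of_cube:
  assumes "finite F"
  obtains m p q where "m \<ge> 1"
    "continuous_map (subtopology (powertop_real UNIV) (cube_on F)) (cube m) p"
    "continuous_map (cube m) (subtopology (powertop_real UNIV) (cube_on F)) q"
    "\<And>t. t \<in> cube_on F \<Longrightarrow> q (p t) = t"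
proof -
  obtain e where e: "bij_betw e {..<card F} F"
    using bij_betw_from_nat_into_finite[OF assms] by blast
  define e' where "e' = the_inv_into {..<card F} e"
  have e': "e' j < card F" "e (e' j) = j" if "j \<in> F" for j
    using that e unfolding e'_def
    by (auto simp: bij_betw_def f_the_inv_into_f dest: the_inv_into_into[where B="{..<card F}"])
  \<comment> \<open>The spare coordinate, set to 0 by \<open>?p\<close> and ignored by
    \<open>?q\<close>, keeps \<open>?m \<ge> 1\<close> even for empty \<open>F\<close>: the
    hypotheses concern positive dimensions.\<close>
  let ?m = "Suc (card F)"
  let ?p = "\<lambda>t. \<lambda>i\<in>{..<?m}. if i < card F then t (e i) else (0::real)"
  let ?q = "\<lambda>s j. if j \<in> F then s (e' j) else (0::real)"
  have eF: "e i \<in> F" if "i < card F" for i using e that by (auto simp: bij_betw_def)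
  have "continuous_map (subtopology (powertop_real UNIV) (cube_on F)) (cube ?m) ?p"
    unfolding cube_def continuous_map_componentwise
  proof (intro conjI ballI)
    fix k assume k: "k \<in> {..<?m}"
    have "continuous_map (subtopology (powertop_real UNIV) (cube_on F)) euclideanreal
        (\<lambda>t. if k < card F then t (e k) else 0)"
      by (cases "k < card F") (simp_all add: continuous_map_from_subtopology continuous_map_product_projection[where X = "\<lambda>_. euclideanreal"])
    moreover have "(\<lambda>t. ?p t k) = (\<lambda>t. if k < card F then t (e k) else 0)"
      using k by auto
    moreover have "(\<lambda>t. if k < card F then t (e k) else 0) \<in> cube_on F \<rightarrow> {0..1}"
      by (auto simp: cube_on_def eF split: if_splits)
    ultimately show "continuous_map (subtopology (powertop_real UNIV) (cube_on F)) (top_of_set {0..1}) (\<lambda>x. ?p x k)"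
      by (auto simp: continuous_map_in_subtopology)
  qed (auto simp: extensional_def)
  moreover have "continuous_map (cube ?m) (subtopology (powertop_real UNIV) (cube_on F)) ?q"
    unfolding continuous_map_in_subtopology continuous_map_componentwise_UNIV
  proof (intro conjI allI)
    fix j
    show "continuous_map (cube ?m) euclideanreal (\<lambda>x. ?q x j)"
    proof (cases "j \<in> F")
      case True
      then have "continuous_map (cube ?m) (top_of_set {0..1}) (\<lambda>x. x (e' j))"
        using e'[of j] unfolding cube_def
        by (intro continuous_map_product_projection) auto
      then show ?thesis using True by (simp add: continuous_map_in_subtopology)
    qed auto
    show "?q \<in> topspace (cube ?m) \<rightarrow> cube_on F"
      using e' by (fastforce simp: cube_def cube_on_def PiE_def Pi_def)
  qed
  moreover have "?q (?p t) = t" if "t \<in> cube_on F" for t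
  proof
    show "?q (?p t) j = t j" for j
      using that e'[of j] by (cases "j \<in> F") (auto simp: cube_on_def dest: spec[where x = j])
  qed
  ultimately show ?thesis using that[of ?m ?p ?q] by simp
qed

lemma continuous_map_prod_top_id:
  assumes "continuous_map Z Z' p"
  shows "continuous_map (prod_topology Z X) (prod_topology Z' X) (\<lambda>(t, x). (p t, x))"
  using assms continuous_map_prod_top[of Z X Z' X p "\<lambda>x. x"] by auto

lemma
  assumes "finite F"
  shows in_AE_cube_on: "(\<And>m. m \<ge> 1 \<Longrightarrow> in_AE K (prod_topology (cube m) X)) \<Longrightarrow>
      in_AE K (prod_topology (subtopology (powertop_real UNIV) (cube_on F)) X)"
    and in_ANE_cube_on: "(\<And>m. m \<ge> 1 \<Longrightarrow> in_ANE K (prod_topology (cube m) X)) \<Longrightarrow>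
      in_ANE K (prod_topology (subtopology (powertop_real UNIV) (cube_on F)) X)"
proof -
  obtain m p q where m: "m \<ge> 1"
    and p: "continuous_map (subtopology (powertop_real UNIV) (cube_on F)) (cube m) p"
    and q: "continuous_map (cube m) (subtopology (powertop_real UNIV) (cube_on F)) q"
    and qp: "\<And>t. t \<in> cube_on F \<Longrightarrow> q (p t) = t"
    using cube_on_retract_of_cube[OF assms] by metis
  note * = continuous_map_prod_top_id[OF p, of X] continuous_map_prod_top_id[OF q, of X]
  show "in_AE K (prod_topology (subtopology (powertop_real UNIV) (cube_on F)) X)"
    if "\<And>m. m \<ge> 1 \<Longrightarrow> in_AE K (prod_topology (cube m) X)"
    by (rule in_AE_retract[OF * _ that[OF m]]) (auto simp: qp)
  show "in_ANE K (prod_topology (subtopology (powertop_real UNIV) (cube_on F)) X)"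
    if "\<And>m. m \<ge> 1 \<Longrightarrow> in_ANE K (prod_topology (cube m) X)"
    by (rule in_ANE_retract[OF * _ that[OF m]]) (auto simp: qp)
qed

section \<open>Pasting, and extension near a fibre\<close>

lemma continuous_map_Un_closed:
  assumes "closedin Z A" "closedin Z B"
    and "continuous_map (subtopology Z A) K a" "continuous_map (subtopology Z B) K b"
    and "\<And>z. z \<in> A \<Longrightarrow> z \<in> B \<Longrightarrow> a z = b z"
  shows "continuous_map (subtopology Z (A \<union> B)) K (\<lambda>z. if z \<in> A then a z else b z)"
proof (rule pasting_lemma_closed[where I = "UNIV::bool set" and T = "\<lambda>i. if i then A else B"
      and f = "\<lambda>i. if i then a else b"])
  fix i :: bool
  show "closedin (subtopology Z (A \<union> B)) (if i then A else B)"
    using assms(1,2) by (auto simp: closedin_closed_subtopology closedin_Un)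
  show "continuous_map (subtopology (subtopology Z (A \<union> B)) (if i then A else B)) K (if i then a else b)"
    using assms(3,4) by (simp add: subtopology_subtopology inf.absorb2)
qed (use assms(5) in \<open>auto split: if_splits\<close>)

text \<open>\<open>AE\<close> fills the part over the fibre, and \<open>ANE\<close> thickens it
  together with \<open>B\<close>. Two closed maps make the thickening uniform: the projection along
  the compact cube, and \<open>f\<close>. The T1 axiom enters because the fibre must be
  closed.\<close>

lemma local_extension:
  fixes F :: "'j set"
  assumes F: "finite F" and clf: "closed_map X Y f" and f: "continuous_map X Y f"
    and "t1_space Y" and y: "y \<in> topspace Y"
    and ANE: "in_ANE K (prod_topology (subtopology (powertop_real UNIV) (cube_on F)) X)"
    and AE: "in_AE K (prod_topology (subtopology (powertop_real UNIV) (cube_on F))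
          (subtopology X {x \<in> topspace X. f x = y}))"
    and B: "closedin (subtopology (param_prod X) (cube_on F \<times> topspace X)) B"
    and \<phi>: "continuous_map (subtopology (param_prod X) B) K \<phi>"
  obtains V G where "openin Y V" "y \<in> V"
    "continuous_map (subtopology (param_prod X) (cube_on F \<times> {x \<in> topspace X. f x \<in> V})) K G"
    "\<And>t x. (t, x) \<in> B \<Longrightarrow> f x \<in> V \<Longrightarrow> G (t, x) = \<phi> (t, x)"
proof -
  let ?Z = "subtopology (param_prod X) (cube_on F \<times> topspace X)"
  let ?P = "{x \<in> topspace X. f x = y}"
  let ?L = "cube_on F \<times> ?P"
  have Z_eq: "prod_topology (subtopology (powertop_real UNIV) (cube_on F)) X = ?Z"
    by (simp add: prod_topology_subtopology)
  have L_eq: "prod_topology (subtopology (powertop_real UNIV) (cube_on F)) (subtopology X ?P) = subtopology (param_prod X) ?L"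
    by (simp add: subtopology_Times)
  have P: "closedin X ?P"
    using closedin_continuous_map_preimage[OF f closedin_t1_singleton[OF \<open>t1_space Y\<close> y]] by simp
  have BZ: "B \<subseteq> cube_on F \<times> topspace X" using closedin_subset[OF B] by auto
  have L: "closedin ?Z ?L"
    unfolding Z_eq[symmetric] closedin_prod_Times_iff
    using P closedin_topspace[of "subtopology (powertop_real UNIV) (cube_on F)"] by simp
  have sub: "subtopology (param_prod X) S = subtopology ?Z S" if "S \<subseteq> cube_on F \<times> topspace X" for S
    using that by (simp add: subtopology_subtopology inf.absorb2)
  have "closedin (subtopology (param_prod X) ?L) (B \<inter> ?L)"
    using B L sub[of ?L] by (auto simp: closedin_subtopology)
  moreover have "continuous_map (subtopology (subtopology (param_prod X) ?L) (B \<inter> ?L)) K \<phi>"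
    unfolding subtopology_subtopology by (rule continuous_map_from_subtopology_mono[OF \<phi>]) blast
  ultimately obtain \<psi> where \<psi>: "continuous_map (subtopology (param_prod X) ?L) K \<psi>"
      "\<forall>z\<in>B \<inter> ?L. \<psi> z = \<phi> z"
    by (rule in_AE_E[OF AE[unfolded L_eq]]) (rule that)
  let ?\<chi> = "\<lambda>z. if z \<in> B then \<phi> z else \<psi> z"
  have cl: "closedin ?Z (B \<union> ?L)" using B L by (rule closedin_Un)
  have "continuous_map (subtopology ?Z (B \<union> ?L)) K ?\<chi>"
  proof (rule continuous_map_Un_closed[OF B L])
    show "continuous_map (subtopology ?Z B) K \<phi>" using \<phi> sub[OF BZ] by simp
    show "continuous_map (subtopology ?Z ?L) K \<psi>" using \<psi>(1) by (subst sub[symmetric]) auto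
  qed (use \<psi>(2) in auto)
  then obtain U h where U: "openin ?Z U" "B \<union> ?L \<subseteq> U"
    and h: "continuous_map (subtopology ?Z U) K h" "\<forall>z\<in>B \<union> ?L. h z = ?\<chi> z"
    by (rule in_ANE_E[OF ANE[unfolded Z_eq] cl]) (rule that)
  \<comment> \<open>\<open>?N\<close> collects the points over which \<open>U\<close> misses some
    part of the cube. It is closed and disjoint from the fibre.\<close>
  let ?N = "snd ` (topspace ?Z - U)"
  have "closed_map ?Z X snd"
    unfolding Z_eq[symmetric] by (rule closed_map_snd[OF compact_space_cube_on])
  then have "closedin X ?N" using U(1) unfolding closed_map_def by blast
  moreover have "?P \<subseteq> topspace X - ?N" using U(2) by auto
  ultimately obtain V where V: "openin Y V" "y \<in> V" "{x \<in> topspace X. f x \<in> V} \<subseteq> topspace X - ?N"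
    using clf y unfolding closed_map_fibre_neighbourhood by (meson openin_diff openin_topspace)
  show ?thesis
  proof (rule that[OF V(1,2)])
    let ?W = "cube_on F \<times> {x \<in> topspace X. f x \<in> V}"
    have W: "?W \<subseteq> U" using V(3) by (force simp: image_iff)
    have "U \<subseteq> cube_on F \<times> topspace X" using openin_subset[OF U(1)] by auto
    then show "continuous_map (subtopology (param_prod X) ?W) K h"
      using continuous_map_from_subtopology_mono[OF h(1) W] by (subst sub) auto
    show "h (t, x) = \<phi> (t, x)" if "(t, x) \<in> B" "f x \<in> V" for t x
      using h(2) that by auto
  qed
qed

lemma continuous_map_finite_closed_cover:
  assumes "finite \<C>" and "\<And>C. C \<in> \<C> \<Longrightarrow> closedin Z C \<and> continuous_map (subtopology Z C) K k"
    and "topspace Z \<subseteq> \<Union>\<C>"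
  shows "continuous_map Z K k"
  by (rule pasting_lemma_closed[where I = \<C> and T = "\<lambda>C. C" and f = "\<lambda>_. k"]) (use assms in auto)

subsection \<open>Regular paracompact spaces\<close>

text \<open>Regularity shrinks each \<open>V y\<close> to a neighbourhood whose closure stays in
  \<open>V y\<close>; paracompactness refines the shrunken cover. The function \<open>y\<close>
  remembers, for each \<open>W\<close>, a point whose shrunken neighbourhood contains
  \<open>W\<close>.\<close>

lemma regular_paracompact_refinement:
  assumes "regular_space Y" "paracompact_space Y"
    and V: "\<And>y. y \<in> topspace Y \<Longrightarrow> openin Y (V y) \<and> y \<in> V y"
  obtains \<W> y where "open_cover_of Y \<W>" "locally_finite_in Y \<W>"
    "\<And>W. W \<in> \<W> \<Longrightarrow> y W \<in> topspace Y \<and> Y closure_of W \<subseteq> V (y W)"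
proof -
  have "\<exists>N. openin Y N \<and> y \<in> N \<and> Y closure_of N \<subseteq> V y" if y: "y \<in> topspace Y" for y
  proof -
    have "closedin Y (topspace Y - V y) \<and> y \<in> topspace Y - (topspace Y - V y)" using V[OF y] y by auto
    then obtain N where "openin Y N" "y \<in> N" "disjnt (topspace Y - V y) (Y closure_of N)"
      using assms(1) unfolding regular_space by meson
    moreover have "Y closure_of N \<subseteq> V y"
      using calculation(3) closure_of_subset_topspace[of Y N] unfolding disjnt_iff by auto
    ultimately show ?thesis by auto
  qed
  then obtain N where N: "\<And>y. y \<in> topspace Y \<Longrightarrow> openin Y (N y) \<and> y \<in> N y \<and> Y closure_of (N y) \<subseteq> V y"
    by metis
  have "\<Union> (N ` topspace Y) = topspace Y"
  proof
    show "\<Union> (N ` topspace Y) \<subseteq> topspace Y" using N openin_subset by (metis UN_least)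
  qed (use N in auto)
  then have "open_cover_of Y (N ` topspace Y)" using N unfolding open_cover_of_def by auto
  then obtain \<W> where \<W>: "open_cover_of Y \<W>" "refines \<W> (N ` topspace Y)" "locally_finite_in Y \<W>"
    using assms(2)[unfolded paracompact_space_def, rule_format] by auto
  have "\<forall>W\<in>\<W>. \<exists>y\<in>topspace Y. W \<subseteq> N y" using \<W>(2) unfolding refines_def by auto
  then obtain y where y: "\<And>W. W \<in> \<W> \<Longrightarrow> y W \<in> topspace Y \<and> W \<subseteq> N (y W)" by metis
  have "Y closure_of W \<subseteq> V (y W)" if "W \<in> \<W>" for W
    using N y[OF that] closure_of_mono[of W "N (y W)" Y] by (meson order_trans)
  with that[OF \<W>(1,3), of y] y show ?thesis by auto
qed

text \<open>Cover \<open>Y\<close> by open sets each missing \<open>S\<close> or \<open>T\<close>.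
  The members of a refinement that meet \<open>S\<close> have closures missing \<open>T\<close>, and
  local finiteness lets closure commute with their union.\<close>

lemma regular_paracompact_imp_normal_space:
  assumes "regular_space Y" "paracompact_space Y"
  shows "normal_space Y"
  unfolding normal_space_def
proof (intro allI impI, elim conjE)
  fix S T assume S: "closedin Y S" and T: "closedin Y T" and "disjnt S T"
  define V where "V y = (if y \<in> S then topspace Y - T else topspace Y - S)" for y
  have "openin Y (V y) \<and> y \<in> V y" if "y \<in> topspace Y" for y
    using that S T \<open>disjnt S T\<close> by (auto simp: V_def disjnt_iff)
  then obtain \<W> y where \<W>: "open_cover_of Y \<W>" "locally_finite_in Y \<W>"
    and y: "\<And>W. W \<in> \<W> \<Longrightarrow> y W \<in> topspace Y \<and> Y closure_of W \<subseteq> V (y W)"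
    using regular_paracompact_refinement[OF assms] by metis
  define \<S> where "\<S> = {W \<in> \<W>. W \<inter> S \<noteq> {}}"
  have opW: "openin Y W" if "W \<in> \<W>" for W using \<W>(1) that by (simp add: open_cover_of_def)
  have lf: "locally_finite_in Y \<S>"
    by (rule locally_finite_in_subset[OF \<W>(2)]) (auto simp: \<S>_def)
  have "Y closure_of W \<inter> T = {}" if "W \<in> \<S>" for W
  proof -
    have W: "W \<in> \<W>" "W \<inter> S \<noteq> {}" using that by (auto simp: \<S>_def)
    have "W \<subseteq> Y closure_of W" using closure_of_subset[OF openin_subset[OF opW[OF W(1)]]] .
    then have "V (y W) \<inter> S \<noteq> {}" using W y[OF W(1)] by blast
    then have "V (y W) \<inter> T = {}" by (auto simp: V_def split: if_splits)
    then show ?thesis using y[OF W(1)] by blast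
  qed
  then have cl: "Y closure_of \<Union>\<S> \<inter> T = {}"
    unfolding closure_of_locally_finite_Union[OF lf] by blast
  have "S \<subseteq> \<Union>\<S>"
  proof
    fix x assume "x \<in> S"
    then have "x \<in> \<Union>\<W>" using closedin_subset[OF S] \<W>(1) by (auto simp: open_cover_of_def)
    then show "x \<in> \<Union>\<S>" using \<open>x \<in> S\<close> unfolding \<S>_def by blast
  qed
  moreover have "openin Y (\<Union>\<S>)" using opW by (intro openin_Union) (auto simp: \<S>_def)
  moreover have "T \<subseteq> topspace Y - Y closure_of \<Union>\<S>" using cl closedin_subset[OF T] by blast
  moreover have "disjnt (\<Union>\<S>) (topspace Y - Y closure_of \<Union>\<S>)"
    using closure_of_subset[OF openin_subset[OF \<open>openin Y (\<Union>\<S>)\<close>]] by (auto simp: disjnt_iff)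
  ultimately show "\<exists>U V. openin Y U \<and> openin Y V \<and> S \<subseteq> U \<and> T \<subseteq> V \<and> disjnt U V"
    by (intro exI[of _ "\<Union>\<S>"] exI[of _ "topspace Y - Y closure_of \<Union>\<S>"]) auto
qed

text \<open>Each member of a refinement is assigned to one index \<open>n\<close> such that its
  closure lies in \<open>U n\<close>. By local finiteness the union of the closures with a given
  index is closed.\<close>

lemma countable_open_cover_closed_shrinking:
  fixes U :: "nat \<Rightarrow> 'b set"
  assumes "regular_space Y" "paracompact_space Y"
    and U: "\<And>n. openin Y (U n)" and cover: "topspace Y \<subseteq> (\<Union>n. U n)"
  obtains C where "\<And>n. closedin Y (C n)" "\<And>n. C n \<subseteq> U n" "topspace Y \<subseteq> (\<Union>n. C n)"
proof -
  have "\<exists>n. z \<in> U n" if "z \<in> topspace Y" for z using cover that by blast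
  then obtain m where m: "\<And>z. z \<in> topspace Y \<Longrightarrow> z \<in> U (m z)" by metis
  obtain \<W> y where \<W>: "open_cover_of Y \<W>" "locally_finite_in Y \<W>"
    and y: "\<And>W. W \<in> \<W> \<Longrightarrow> y W \<in> topspace Y \<and> Y closure_of W \<subseteq> U (m (y W))"
    using regular_paracompact_refinement[OF assms(1,2), of "\<lambda>z. U (m z)"] U m by auto
  define C where "C n = Y closure_of \<Union>{W \<in> \<W>. m (y W) = n}" for n
  have C_eq: "C n = \<Union>((closure_of) Y ` {W \<in> \<W>. m (y W) = n})" for n
    unfolding C_def
    by (rule closure_of_locally_finite_Union, rule locally_finite_in_subset[OF \<W>(2)]) auto
  show ?thesis
  proof (rule that[of C])
    show "closedin Y (C n)" for n unfolding C_def by simp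
    show "C n \<subseteq> U n" for n unfolding C_eq using y by blast
    show "topspace Y \<subseteq> (\<Union>n. C n)"
    proof
      fix z assume "z \<in> topspace Y"
      then obtain W where W: "W \<in> \<W>" "z \<in> W" using \<W>(1) by (auto simp: open_cover_of_def)
      have "W \<subseteq> Y closure_of W"
        using W(1) \<W>(1) by (intro closure_of_subset openin_subset) (auto simp: open_cover_of_def)
      then have "z \<in> C (m (y W))" unfolding C_eq using W by blast
      then show "z \<in> (\<Union>n. C n)" by blast
    qed
  qed
qed

section \<open>Weight functions for a countable cover\<close>

definition clamp01 :: "real \<Rightarrow> real" where "clamp01 s = max 0 (min 1 s)"

text \<open>A substitute for a partition of unity, normalised by some value being 1 instead of by
  the sum; \<open>p n\<close> will be the weight of the vertex on level \<open>n\<close>. The closed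
  sets \<open>D n\<close> ensure that a point outside \<open>D n\<close> has a whole neighbourhood
  on which \<open>p n\<close> vanishes.\<close>

lemma countable_open_cover_functions:
  fixes U :: "nat \<Rightarrow> 'b set"
  assumes "regular_space Y" "paracompact_space Y"
    and U: "\<And>n. openin Y (U n)" and cover: "topspace Y \<subseteq> (\<Union>n. U n)"
  obtains p :: "nat \<Rightarrow> 'b \<Rightarrow> real" and D where
    "\<And>n. continuous_map Y euclideanreal (p n)" "\<And>n z. 0 \<le> p n z \<and> p n z \<le> 1"
    "\<And>n. closedin Y (D n)" "\<And>n. D n \<subseteq> U n"
    "\<And>n z. z \<in> topspace Y \<Longrightarrow> p n z \<noteq> 0 \<Longrightarrow> z \<in> D n"
    "\<And>z. z \<in> topspace Y \<Longrightarrow> \<exists>n. p n z = 1"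
    "\<And>z. z \<in> topspace Y \<Longrightarrow> \<exists>V m. openin Y V \<and> z \<in> V \<and> (\<forall>n w. w \<in> V \<longrightarrow> p n w \<noteq> 0 \<longrightarrow> n \<le> m)"
proof -
  obtain C where C: "\<And>n. closedin Y (C n)" "\<And>n. C n \<subseteq> U n" "topspace Y \<subseteq> (\<Union>n. C n)"
    using countable_open_cover_closed_shrinking[OF assms] by blast
  have normal: "normal_space Y" by (rule regular_paracompact_imp_normal_space[OF assms(1,2)])
  have "\<exists>r. continuous_map Y euclideanreal r \<and> r ` (topspace Y - U n) \<subseteq> {0} \<and> r ` C n \<subseteq> {1}" for n
  proof -
    have "disjnt (topspace Y - U n) (C n)" using C(2)[of n] by (auto simp: disjnt_iff)
    then obtain r :: "'b \<Rightarrow> real" where "continuous_map Y euclideanreal r" "r ` (topspace Y - U n) \<subseteq> {0}" "r ` C n \<subseteq> {1}"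
      using Urysohn_lemma_alt[OF normal, of "topspace Y - U n" "C n" 0 1] U[of n] C(1)[of n] by blast
    then show ?thesis by blast
  qed
  then obtain r where r: "\<And>n. continuous_map Y euclideanreal (r n)"
    and r0: "\<And>n. r n ` (topspace Y - U n) \<subseteq> {0}" and r1: "\<And>n. r n ` C n \<subseteq> {1::real}" by metis
  \<comment> \<open>The product kills \<open>p n\<close> near every point where an earlier \<open>r i\<close> equals 1; the first \<open>n\<close> with
    \<open>r n z \<ge> 3/4\<close> has \<open>p n z = 1\<close>.\<close>
  define p where "p n z = clamp01 (4 * r n z - 2) * (\<Prod>i<n. clamp01 (7 * (9/10 - r i z)))" for n z
  have clamp: "0 \<le> clamp01 s" "clamp01 s \<le> 1" for s by (auto simp: clamp01_def)
  show ?thesis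
  \<comment> \<open>The threshold 1/2 is where the factor \<open>clamp01 (4 * r n z - 2)\<close>
    starts to be positive.\<close>
  proof (rule that[of p "\<lambda>n. {z \<in> topspace Y. r n z \<in> {1/2..}}"])
    show "continuous_map Y euclideanreal (p n)" for n
      unfolding p_def clamp01_def by (intro continuous_intros r) auto
    show "0 \<le> p n z \<and> p n z \<le> 1" for n z
      unfolding p_def by (auto intro!: mult_nonneg_nonneg mult_le_one prod_nonneg prod_le_1 simp: clamp)
    show "closedin Y {z \<in> topspace Y. r n z \<in> {1/2..}}" for n
      by (rule closedin_continuous_map_preimage[OF r]) simp
    show "{z \<in> topspace Y. r n z \<in> {1/2..}} \<subseteq> U n" for n
      using r0[of n] by fastforce
    show "z \<in> {z \<in> topspace Y. r n z \<in> {1/2..}}" if "z \<in> topspace Y" "p n z \<noteq> 0" for n z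
      using that by (auto simp: p_def clamp01_def)
    show "\<exists>n. p n z = 1" if z: "z \<in> topspace Y" for z
    proof -
      obtain k where "z \<in> C k" using C(3) z by blast
      then have "r k z \<ge> 3/4" using r1[of k] by auto
      define n where "n = (LEAST n. r n z \<ge> 3/4)"
      have "r n z \<ge> 3/4" unfolding n_def using \<open>r k z \<ge> 3/4\<close> by (rule LeastI)
      then have "clamp01 (4 * r n z - 2) = 1" by (simp add: clamp01_def)
      \<comment> \<open>By minimality \<open>r i z < 3/4\<close>, and
        \<open>7 * (9/10 - 3/4) > 1\<close>, so the clamp is saturated.\<close>
      moreover have "clamp01 (7 * (9/10 - r i z)) = 1" if "i < n" for i
        using not_less_Least[OF that[unfolded n_def]] by (simp add: clamp01_def)
      ultimately have "p n z = 1" by (simp add: p_def)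
      then show ?thesis ..
    qed
    show "\<exists>V m. openin Y V \<and> z \<in> V \<and> (\<forall>n w. w \<in> V \<longrightarrow> p n w \<noteq> 0 \<longrightarrow> n \<le> m)" if z: "z \<in> topspace Y" for z
    proof -
      obtain k where k: "z \<in> C k" using C(3) z by blast
      \<comment> \<open>On this set the factor with index \<open>k\<close> is 0, which kills
        \<open>p n\<close> for every \<open>n > k\<close>.\<close>
      let ?V = "{w \<in> topspace Y. r k w \<in> {9/10<..}}"
      have "openin Y ?V" by (rule openin_continuous_map_preimage[OF r]) simp
      moreover have "z \<in> ?V" using k z r1[of k] by auto
      moreover have "n \<le> k" if "w \<in> ?V" "p n w \<noteq> 0" for n w
      proof (rule ccontr)
        assume "\<not> n \<le> k"
        then have "(\<Prod>i<n. clamp01 (7 * (9/10 - r i w))) = 0"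
          using that(1) by (intro prod_zero) (auto simp: clamp01_def intro!: bexI[of _ k])
        then show False using that(2) by (simp add: p_def)
      qed
      ultimately show ?thesis by blast
    qed
  qed
qed

subsection \<open>Families of local extensions over the nerve\<close>

text \<open>Points \<open>t\<close> of the nerve are normalised by \<open>max = 1\<close> instead of \<open>sum = 1\<close>. An index \<open>(i, U)\<close>
  stands for the member \<open>U\<close> of the \<open>i\<close>-th cover, and closures are used so that the graph is closed.\<close>

definition nerve_graph ::
  "'b topology \<Rightarrow> 'a topology \<Rightarrow> ('a \<Rightarrow> 'b) \<Rightarrow> (nat \<times> 'b set) set \<Rightarrow> ((nat \<times> 'b set \<Rightarrow> real) \<times> 'a) set" where
  "nerve_graph Y X f \<Omega> = {(t, x). t \<in> cube_on \<Omega> \<and> x \<in> topspace X \<and> (\<exists>j. t j = 1) \<and>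
     (\<forall>i U V. t (i, U) \<noteq> 0 \<and> t (i, V) \<noteq> 0 \<longrightarrow> U = V) \<and>
     (\<forall>i U. t (i, U) \<noteq> 0 \<longrightarrow> f x \<in> Y closure_of U)}"

lemma cube_on_eq_0: "t \<in> cube_on F \<Longrightarrow> j \<notin> F \<Longrightarrow> t j = 0"
  unfolding cube_on_def by (auto dest: spec[where x = j])

lemma cube_on_supp: "t \<in> cube_on F \<Longrightarrow> t j \<noteq> 0 \<Longrightarrow> j \<in> F"
  using cube_on_eq_0 by metis

lemma cube_on_iff: "t \<in> cube_on F \<longleftrightarrow> (\<forall>j. 0 \<le> t j \<and> t j \<le> 1) \<and> (\<forall>j. j \<notin> F \<longrightarrow> t j = 0)"
proof -
  have "(t j \<in> (if j \<in> F then {0..1} else {0})) \<longleftrightarrow> (0 \<le> t j \<and> t j \<le> 1) \<and> (j \<notin> F \<longrightarrow> t j = 0)" for j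
    by auto
  then show ?thesis unfolding cube_on_def by blast
qed

lemma cube_on_bounds: "t \<in> cube_on F \<Longrightarrow> 0 \<le> t j" "t \<in> cube_on F \<Longrightarrow> t j \<le> 1"
  using cube_on_iff[of t F] by blast+

lemma nerve_graph_D:
  assumes "(t, x) \<in> nerve_graph Y X f \<Omega>"
  shows "t \<in> cube_on \<Omega>" "x \<in> topspace X" "\<And>j. t j \<noteq> 0 \<Longrightarrow> f x \<in> Y closure_of snd j"
    and "\<And>i U V. t (i, U) \<noteq> 0 \<Longrightarrow> t (i, V) \<noteq> 0 \<Longrightarrow> U = V"
  using assms by (auto simp: nerve_graph_def)

text \<open>The index set enters the nerve graph only as a bound for the support of
  \<open>t\<close>, so it may be replaced by any set containing that support.\<close>

lemma nerve_graph_shrink: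
  assumes "(t, x) \<in> nerve_graph Y X f \<Omega>" "\<And>j. t j \<noteq> 0 \<Longrightarrow> j \<in> \<Omega>'"
  shows "(t, x) \<in> nerve_graph Y X f \<Omega>'"
proof -
  have "t \<in> cube_on \<Omega>'" using assms by (auto simp: nerve_graph_def cube_on_iff)
  then show ?thesis using assms(1) by (simp add: nerve_graph_def)
qed

lemma nerve_graph_subset: "nerve_graph Y X f \<Omega> \<subseteq> cube_on \<Omega> \<times> topspace X"
  by (auto simp: nerve_graph_def)

lemma nerve_graph_mono: "\<Omega> \<subseteq> \<Omega>' \<Longrightarrow> nerve_graph Y X f \<Omega> \<subseteq> nerve_graph Y X f \<Omega>'"
  using cube_on_mono[of \<Omega> \<Omega>'] by (auto simp: nerve_graph_def)

section \<open>Closedness of the nerve graph over finitely many indices\<close>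

lemma continuous_map_param_coord:
  "continuous_map (subtopology (param_prod X) S) euclideanreal (\<lambda>z. fst z j)"
proof (rule continuous_map_from_subtopology)
  have "continuous_map (powertop_real UNIV) euclideanreal (\<lambda>t. t j)"
    by (rule continuous_map_product_projection[where X = "\<lambda>_. euclideanreal"]) simp
  from continuous_map_compose[OF continuous_map_fst this]
  show "continuous_map (param_prod X) euclideanreal (\<lambda>z. fst z j)" by (simp add: o_def)
qed

lemma continuous_map_param_snd:
  "continuous_map X Y f \<Longrightarrow> continuous_map (subtopology (param_prod X) S) Y (\<lambda>z. f (snd z))"
  using continuous_map_compose[OF continuous_map_snd, of X Y f]
  by (auto simp: o_def intro: continuous_map_from_subtopology)

lemma closedin_param_coord:
  "closed C \<Longrightarrow> closedin (subtopology (param_prod X) S) {z \<in> topspace (subtopology (param_prod X) S). fst z j \<in> C}"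
  by (rule closedin_continuous_map_preimage[OF continuous_map_param_coord]) simp

lemma closedin_param_snd:
  "continuous_map X Y f \<Longrightarrow> closedin Y C \<Longrightarrow>
    closedin (subtopology (param_prod X) S) {z \<in> topspace (subtopology (param_prod X) S). f (snd z) \<in> C}"
  by (rule closedin_continuous_map_preimage[OF continuous_map_param_snd])

lemma closedin_Collect_Ball:
  assumes "\<And>i. i \<in> I \<Longrightarrow> closedin Z {z \<in> topspace Z. P i z}"
  shows "closedin Z {z \<in> topspace Z. \<forall>i\<in>I. P i z}"
proof -
  have "{z \<in> topspace Z. \<forall>i\<in>I. P i z} = \<Inter> (insert (topspace Z) ((\<lambda>i. {z \<in> topspace Z. P i z}) ` I))"
    by auto
  also have "closedin Z \<dots>" using assms by (intro closedin_Inter) auto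
  finally show ?thesis .
qed

lemma closedin_Collect_disj:
  assumes "closedin Z {z \<in> topspace Z. P z}" "closedin Z {z \<in> topspace Z. Q z}"
  shows "closedin Z {z \<in> topspace Z. P z \<or> Q z}"
  using closedin_Un[OF assms] by (simp add: Collect_disj_eq[symmetric] conj_disj_distribL)

lemma closedin_Collect_conj:
  assumes "closedin Z {z \<in> topspace Z. P z}" "closedin Z {z \<in> topspace Z. Q z}"
  shows "closedin Z {z \<in> topspace Z. P z \<and> Q z}"
proof -
  have "{z \<in> topspace Z. P z \<and> Q z} = {z \<in> topspace Z. P z} \<inter> {z \<in> topspace Z. Q z}" by auto
  then show ?thesis using closedin_Int[OF assms] by simp
qed

text \<open>For finite \<open>F\<close>, having a coordinate 1 is a finite union of closed
  conditions. The other two requirements are possibly infinite intersections of closed alternatives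
  of the form "this coordinate is zero, or ...".\<close>

lemma closedin_nerve_graph:
  fixes X :: "'a topology" and Y :: "'b topology"
  assumes "finite F" and f: "continuous_map X Y f"
  shows "closedin (subtopology (param_prod X) (cube_on F \<times> topspace X)) (nerve_graph Y X f F)"
proof -
  let ?Z = "subtopology (param_prod X) (cube_on F \<times> topspace X) :: ((nat \<times> 'b set \<Rightarrow> real) \<times> 'a) topology"
  have 0: "closedin ?Z {z \<in> topspace ?Z. fst z j = c}" for j c
    using closedin_param_coord[of "{c}" X "cube_on F \<times> topspace X" j] by simp
  have "closedin ?Z (\<Union>j\<in>F. {z \<in> topspace ?Z. fst z j = 1})"
    using \<open>finite F\<close> 0 by (intro closedin_Union) auto
  moreover have "(\<Union>j\<in>F. {z \<in> topspace ?Z. fst z j = 1}) = {z \<in> topspace ?Z. \<exists>j\<in>F. fst z j = 1}" by auto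
  ultimately have 1: "closedin ?Z {z \<in> topspace ?Z. \<exists>j\<in>F. fst z j = 1}" by simp
  have 2: "closedin ?Z {z \<in> topspace ?Z. \<forall>p\<in>{(j, k). fst j = fst k \<and> snd j \<noteq> snd k}.
      fst z (fst p) = 0 \<or> fst z (snd p) = 0}"
    by (rule closedin_Collect_Ball) (intro closedin_Collect_disj 0)
  have 3: "closedin ?Z {z \<in> topspace ?Z. \<forall>j\<in>UNIV. fst z j = 0 \<or> f (snd z) \<in> Y closure_of (snd j)}"
    by (rule closedin_Collect_Ball) (intro closedin_Collect_disj 0 closedin_param_snd[OF f] closedin_closure_of)
  have "nerve_graph Y X f F = {z \<in> topspace ?Z. (\<exists>j\<in>F. fst z j = 1) \<and>
      (\<forall>p\<in>{(j, k). fst j = fst k \<and> snd j \<noteq> snd k}. fst z (fst p) = 0 \<or> fst z (snd p) = 0) \<and>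
      (\<forall>j\<in>UNIV. fst z j = 0 \<or> f (snd z) \<in> Y closure_of (snd j))}" (is "_ = ?R")
  proof -
    have "(t, x) \<in> nerve_graph Y X f F \<longleftrightarrow> (t, x) \<in> ?R" for t x
    proof -
      have Z: "(t, x) \<in> topspace ?Z \<longleftrightarrow> t \<in> cube_on F \<and> x \<in> topspace X" by auto
      have "(\<exists>j. t j = 1) \<longleftrightarrow> (\<exists>j\<in>F. t j = 1)" if "t \<in> cube_on F"
        using cube_on_eq_0[OF that] zero_neq_one by metis
      moreover have "(\<forall>i U V. t (i, U) \<noteq> 0 \<and> t (i, V) \<noteq> 0 \<longrightarrow> U = V) \<longleftrightarrow>
          (\<forall>p\<in>{(j, k). fst j = fst k \<and> snd j \<noteq> snd k}. t (fst p) = 0 \<or> t (snd p) = 0)"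
        unfolding Ball_def split_paired_All mem_Collect_eq prod.case fst_conv snd_conv by blast
      moreover have "(\<forall>i U. t (i, U) \<noteq> 0 \<longrightarrow> f x \<in> Y closure_of U) \<longleftrightarrow>
          (\<forall>j\<in>UNIV. t j = 0 \<or> f x \<in> Y closure_of snd j)"
        unfolding Ball_def split_paired_All snd_conv by blast
      ultimately show ?thesis unfolding nerve_graph_def mem_Collect_eq prod.case Z fst_conv snd_conv by argo
    qed
    from this[of "fst z" "snd z" for z] show ?thesis unfolding prod.collapse by (rule set_eqI)
  qed
  with closedin_Collect_conj[OF 1 closedin_Collect_conj[OF 2 3]] show ?thesis by simp
qed

text \<open>Indices are counted, not sets: the same set may occur on many levels, which local
  finiteness of the family of sets would not notice.\<close>

definition index_locally_finite :: "'b topology \<Rightarrow> (nat \<times> 'b set) set \<Rightarrow> bool" where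
  "index_locally_finite Y \<Omega> \<longleftrightarrow>
     (\<forall>y\<in>topspace Y. \<exists>V. openin Y V \<and> y \<in> V \<and> finite {j \<in> \<Omega>. snd j \<inter> V \<noteq> {}})"

lemma index_locally_finite_Un:
  assumes "index_locally_finite Y \<Omega>" "locally_finite_in Y \<W>"
  shows "index_locally_finite Y (\<Omega> \<union> {n} \<times> \<W>)"
  unfolding index_locally_finite_def
proof
  fix y assume y: "y \<in> topspace Y"
  obtain V1 where V1: "openin Y V1" "y \<in> V1" "finite {j \<in> \<Omega>. snd j \<inter> V1 \<noteq> {}}"
    using assms(1)[unfolded index_locally_finite_def, rule_format, OF y] by (elim exE conjE) (rule that)
  obtain V2 where V2: "openin Y V2" "y \<in> V2" "finite {W \<in> \<W>. W \<inter> V2 \<noteq> {}}"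
    using assms(2)[unfolded locally_finite_in_def, THEN conjunct2, rule_format, OF y]
    by (elim exE conjE) (rule that)
  have "{j \<in> \<Omega> \<union> {n} \<times> \<W>. snd j \<inter> (V1 \<inter> V2) \<noteq> {}} \<subseteq>
      {j \<in> \<Omega>. snd j \<inter> V1 \<noteq> {}} \<union> {n} \<times> {W \<in> \<W>. W \<inter> V2 \<noteq> {}}"
  proof
    fix j assume "j \<in> {j \<in> \<Omega> \<union> {n} \<times> \<W>. snd j \<inter> (V1 \<inter> V2) \<noteq> {}}"
    then have "j \<in> \<Omega> \<or> fst j = n \<and> snd j \<in> \<W>" "snd j \<inter> (V1 \<inter> V2) \<noteq> {}"
      by (simp_all add: mem_Times_iff)
    moreover from this(2) have "snd j \<inter> V1 \<noteq> {}" "snd j \<inter> V2 \<noteq> {}" by blast+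
    ultimately show "j \<in> {j \<in> \<Omega>. snd j \<inter> V1 \<noteq> {}} \<union> {n} \<times> {W \<in> \<W>. W \<inter> V2 \<noteq> {}}"
      by (simp add: mem_Times_iff)
  qed
  then have "finite {j \<in> \<Omega> \<union> {n} \<times> \<W>. snd j \<inter> (V1 \<inter> V2) \<noteq> {}}"
    by (rule finite_subset) (simp add: V1(3) V2(3))
  then show "\<exists>V. openin Y V \<and> y \<in> V \<and> finite {j \<in> \<Omega> \<union> {n} \<times> \<W>. snd j \<inter> V \<noteq> {}}"
    using V1(1,2) V2(1,2) by (intro exI[of _ "V1 \<inter> V2"] conjI openin_Int IntI)
qed

text \<open>Fixes a single extension problem \<open>A\<close>, \<open>g\<close>. The extension
  hypotheses are taken in the form for coordinate cubes, with pairs of a level and a set as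
  coordinates.\<close>

locale fibrewise_extension =
  fixes X :: "'a topology" and Y :: "'b topology" and K :: "'k topology" and f :: "'a \<Rightarrow> 'b"
    and A :: "'a set" and g :: "'a \<Rightarrow> 'k"
  assumes contf: "continuous_map X Y f" and closedf: "closed_map X Y f"
    and regY: "regular_space Y" and t1Y: "t1_space Y" and paraY: "paracompact_space Y"
    and closedA: "closedin X A" and contg: "continuous_map (subtopology X A) K g"
    and ANE: "\<And>F :: (nat \<times> 'b set) set. finite F \<Longrightarrow>
      in_ANE K (prod_topology (subtopology (powertop_real UNIV) (cube_on F)) X)"
    and AE: "\<And>(F :: (nat \<times> 'b set) set) y. finite F \<Longrightarrow> y \<in> topspace Y \<Longrightarrow>
      in_AE K (prod_topology (subtopology (powertop_real UNIV) (cube_on F))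
        (subtopology X {x \<in> topspace X. f x = y}))"
begin

abbreviation "NG \<equiv> nerve_graph Y X f"

text \<open>Continuity is asked only over finite \<open>F\<close>, in the spirit of the weak
  topology of a complex. This suffices because the map into the nerve will locally involve only
  finitely many vertices.\<close>

definition partial_system where
  "partial_system \<Omega> H \<longleftrightarrow>
     (\<forall>F \<subseteq> \<Omega>. finite F \<longrightarrow> continuous_map (subtopology (param_prod X) (NG F)) K (\<lambda>(t, x). H t x) \<and>
        (\<forall>t x. (t, x) \<in> NG F \<longrightarrow> x \<in> A \<longrightarrow> H t x = g x))"

lemma partial_system_D:
  assumes "partial_system \<Omega> H" "F \<subseteq> \<Omega>" "finite F"
  shows "continuous_map (subtopology (param_prod X) (NG F)) K (\<lambda>(t, x). H t x)"
    and "\<And>t x. (t, x) \<in> NG F \<Longrightarrow> x \<in> A \<Longrightarrow> H t x = g x"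
  using assms unfolding partial_system_def by auto

text \<open>The third clause puts every index that can occur over \<open>V\<close> into
  \<open>S\<close>, so nerve points for \<open>\<Omega>\<close> over \<open>V\<close> have support
  in \<open>S\<close>. As \<open>G\<close> lives on the whole cube, it may be evaluated off the
  nerve, and the last clause controls it there too.\<close>

definition local_solution where
  "local_solution \<Omega> H y S V G \<longleftrightarrow> openin Y V \<and> y \<in> V \<and>
     (\<forall>j z. j \<in> \<Omega> \<longrightarrow> z \<in> V \<longrightarrow> z \<in> Y closure_of snd j \<longrightarrow> j \<in> S) \<and>
     continuous_map (subtopology (param_prod X) (cube_on S \<times> {x \<in> topspace X. f x \<in> V})) K G \<and>
     (\<forall>t x. (t, x) \<in> NG S \<longrightarrow> f x \<in> V \<longrightarrow> G (t, x) = H t x) \<and>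
     (\<forall>t x. t \<in> cube_on S \<longrightarrow> x \<in> A \<longrightarrow> f x \<in> V \<longrightarrow> G (t, x) = g x)"

lemma local_solution_D:
  assumes "local_solution \<Omega> H y S V G"
  shows "openin Y V" "y \<in> V"
    and "\<And>j z. j \<in> \<Omega> \<Longrightarrow> z \<in> V \<Longrightarrow> z \<in> Y closure_of snd j \<Longrightarrow> j \<in> S"
    and "continuous_map (subtopology (param_prod X) (cube_on S \<times> {x \<in> topspace X. f x \<in> V})) K G"
    and "\<And>t x. (t, x) \<in> NG S \<Longrightarrow> f x \<in> V \<Longrightarrow> G (t, x) = H t x"
    and "\<And>t x. t \<in> cube_on S \<Longrightarrow> x \<in> A \<Longrightarrow> f x \<in> V \<Longrightarrow> G (t, x) = g x"
  using assms unfolding local_solution_def by (simp_all del: split_paired_All)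

text \<open>\<open>local_extension\<close> is applied to \<open>H\<close> on the nerve graph of a
  finite \<open>S\<close>, glued with \<open>g\<close> on \<open>cube_on S \<times> A\<close>. The
  second piece secures the values on \<open>A\<close> at parameters off the nerve.\<close>

lemma local_solution_exists:
  assumes LF: "index_locally_finite Y \<Omega>" and H: "partial_system \<Omega> H" and y: "y \<in> topspace Y"
  shows "\<exists>S V G. local_solution \<Omega> H y S V G"
proof -
  obtain V1 where V1: "openin Y V1" "y \<in> V1" "finite {j \<in> \<Omega>. snd j \<inter> V1 \<noteq> {}}"
    using LF[unfolded index_locally_finite_def, rule_format, OF y] by (elim exE conjE) (rule that)
  define S where "S = {j \<in> \<Omega>. snd j \<inter> V1 \<noteq> {}}"
  have S: "finite S" "S \<subseteq> \<Omega>" using V1 by (auto simp: S_def)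
  let ?Z = "subtopology (param_prod X) (cube_on S \<times> topspace X)"
  let ?B = "cube_on S \<times> A"
  let ?\<phi> = "\<lambda>z. if z \<in> NG S then (case z of (t, x) \<Rightarrow> H t x) else g (snd z)"
  have AX: "A \<subseteq> topspace X" using closedin_subset[OF closedA] .
  have sub: "subtopology (param_prod X) C = subtopology ?Z C" if "C \<subseteq> cube_on S \<times> topspace X" for C
    using that by (simp add: subtopology_subtopology inf.absorb2)
  have clNG: "closedin ?Z (NG S)" by (rule closedin_nerve_graph[OF S(1) contf])
  have "closedin ?Z {z \<in> topspace ?Z. snd z \<in> A}"
    using closedin_param_snd[OF continuous_map_id closedA] by simp
  moreover have "{z \<in> topspace ?Z. snd z \<in> A} = ?B" using AX by auto
  ultimately have clB: "closedin ?Z ?B" by simp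
  have "continuous_map (subtopology ?Z (NG S \<union> ?B)) K ?\<phi>"
  proof (rule continuous_map_Un_closed[OF clNG clB])
    show "continuous_map (subtopology ?Z (NG S)) K (\<lambda>z. case z of (t, x) \<Rightarrow> H t x)"
      using partial_system_D(1)[OF H S(2,1)] by (subst sub[symmetric]) (auto simp: nerve_graph_subset)
    have "continuous_map (subtopology (param_prod X) ?B) (subtopology X A) snd"
      by (auto simp: continuous_map_in_subtopology continuous_map_from_subtopology continuous_map_snd)
    from continuous_map_compose[OF this contg]
    show "continuous_map (subtopology ?Z ?B) K (\<lambda>z. g (snd z))"
      using AX by (subst sub[symmetric]) (auto simp: o_def)
    fix z assume z: "z \<in> NG S" "z \<in> ?B"
    then show "(case z of (t, x) \<Rightarrow> H t x) = g (snd z)"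
      using partial_system_D(2)[OF H S(2,1)] by auto
  qed
  moreover have "NG S \<union> ?B \<subseteq> cube_on S \<times> topspace X" using AX nerve_graph_subset by blast
  ultimately have cont: "continuous_map (subtopology (param_prod X) (NG S \<union> ?B)) K ?\<phi>"
    by (subst sub) auto
  obtain V2 G where V2: "openin Y V2" "y \<in> V2"
    and G: "continuous_map (subtopology (param_prod X) (cube_on S \<times> {x \<in> topspace X. f x \<in> V2})) K G"
      "\<And>t x. (t, x) \<in> NG S \<union> ?B \<Longrightarrow> f x \<in> V2 \<Longrightarrow> G (t, x) = ?\<phi> (t, x)"
    using local_extension[OF S(1) closedf contf t1Y y ANE[OF S(1)] AE[OF S(1) y]
        closedin_Un[OF clNG clB] cont] by blast
  have "local_solution \<Omega> H y S (V1 \<inter> V2) G"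
    unfolding local_solution_def
  proof (intro conjI allI impI)
    \<comment> \<open>An open set meeting the closure of \<open>snd j\<close> meets
      \<open>snd j\<close> itself.\<close>
    show "j \<in> S" if "j \<in> \<Omega>" "z \<in> V1 \<inter> V2" "z \<in> Y closure_of snd j" for j z
      using that V1(1) unfolding S_def in_closure_of by blast
    show "continuous_map (subtopology (param_prod X) (cube_on S \<times> {x \<in> topspace X. f x \<in> V1 \<inter> V2})) K G"
      by (rule continuous_map_from_subtopology_mono[OF G(1)]) auto
    show "G (t, x) = H t x" if "(t, x) \<in> NG S" "f x \<in> V1 \<inter> V2" for t x
      using G(2) that by auto
    show "G (t, x) = g x" if "t \<in> cube_on S" "x \<in> A" "f x \<in> V1 \<inter> V2" for t x
    proof (cases "(t, x) \<in> NG S")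
      case True
      then have "H t x = g x" using that partial_system_D(2)[OF H S(2,1)] by auto
      then show ?thesis using G(2)[of t x] that True by auto
    qed (use G(2)[of t x] that in auto)
  qed (use V1(1,2) V2 in auto)
  then show ?thesis by blast
qed

text \<open>Once some level-\<open>n\<close> coordinate is nonzero, the new family forgets its value and uses the
  local solution belonging to that vertex, evaluated at the coordinates of lower level. As this
  solution is defined on the full cube, no normalisation of the remaining coordinates is needed.\<close>

lemma partial_system_step:
  assumes LF: "index_locally_finite Y \<Omega>" and H: "partial_system \<Omega> H" and level: "\<Omega> \<subseteq> {..<n} \<times> UNIV"
  obtains \<W> H' where "open_cover_of Y \<W>" "locally_finite_in Y \<W>"
    "partial_system (\<Omega> \<union> {n} \<times> \<W>) H'" "\<forall>t x. (t, x) \<in> NG \<Omega> \<longrightarrow> H' t x = H t x"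
proof -
  obtain S V G where SVG: "\<And>y. y \<in> topspace Y \<Longrightarrow> local_solution \<Omega> H y (S y) (V y) (G y)"
    using local_solution_exists[OF LF H] by metis
  have "openin Y (V y) \<and> y \<in> V y" if "y \<in> topspace Y" for y using local_solution_D(1,2)[OF SVG[OF that]] by simp
  \<comment> \<open>Closures have to fit into \<open>V (y W)\<close>, since the nerve graph only
    places \<open>f x\<close> in the closure of \<open>W\<close>.\<close>
  then obtain \<W> y where \<W>: "open_cover_of Y \<W>" "locally_finite_in Y \<W>"
    and y: "\<And>W. W \<in> \<W> \<Longrightarrow> y W \<in> topspace Y \<and> Y closure_of W \<subseteq> V (y W)"
    using regular_paracompact_refinement[OF regY paraY] by metis
  note sol = local_solution_D[OF SVG[OF y[THEN conjunct1]]]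
  let ?\<Omega> = "\<Omega> \<union> {n} \<times> \<W>"
  define cut where "cut t = (\<lambda>j. if fst j < n then t j else (0::real))" for t :: "nat \<times> 'b set \<Rightarrow> real"
  \<comment> \<open>On the new nerve graph at most one coordinate of level \<open>n\<close> is
    nonzero, so \<open>SOME\<close> has only one candidate.\<close>
  define H' where "H' t x = (if \<exists>W. t (n, W) \<noteq> 0 then G (y (SOME W. t (n, W) \<noteq> 0)) (cut t, x) else H t x)" for t x
  \<comment> \<open>A nonzero coordinate of \<open>cut t\<close> belongs to an index in
    \<open>\<Omega>\<close> whose set has \<open>f x\<close> in its closure. Since
    \<open>f x\<close> lies in \<open>V (y W)\<close>, that index is in
    \<open>S (y W)\<close>.\<close>
  have cut_supp: "cut t \<in> cube_on (S (y W))" if "(t, x) \<in> NG ?\<Omega>" "W \<in> \<W>" "f x \<in> Y closure_of W" for t x W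
    unfolding cube_on_iff
  proof (intro conjI allI impI)
    note t = nerve_graph_D[OF that(1)]
    from t(1) show "0 \<le> cut t j" "cut t j \<le> 1" for j by (auto simp: cut_def cube_on_bounds)
    fix j assume j: "j \<notin> S (y W)"
    show "cut t j = 0"
    proof (rule ccontr)
      assume "cut t j \<noteq> 0"
      then have tj: "t j \<noteq> 0" and "fst j < n" by (auto simp: cut_def split: if_splits)
      then have "j \<in> \<Omega>" using cube_on_supp[OF t(1) tj] \<open>fst j < n\<close> by auto
      moreover have "f x \<in> Y closure_of snd j" using t(3)[OF tj] .
      moreover have "f x \<in> V (y W)" using y[OF that(2)] that(3) by auto
      ultimately have "j \<in> S (y W)" using sol(3)[OF that(2)] by blast
      with j show False by simp
    qed
  qed
  have cut_eq: "(t, x) \<in> NG \<Omega> \<and> cut t = t" if "(t, x) \<in> NG ?\<Omega>" "\<And>W. t (n, W) = 0" for t x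
  proof -
    have supp: "j \<in> \<Omega>" if "t j \<noteq> 0" for j
      using cube_on_supp[OF nerve_graph_D(1)[OF \<open>(t, x) \<in> NG ?\<Omega>\<close>] that] that \<open>\<And>W. t (n, W) = 0\<close>
      by (cases j) auto
    have "cut t j = t j" for j
      using supp[of j] level by (cases j) (auto simp: cut_def)
    then have "cut t = t" by (rule ext)
    then show ?thesis using nerve_graph_shrink[OF that(1) supp] by simp
  qed
  \<comment> \<open>Old and new values match where the weight on level \<open>n\<close> reaches 0;
    this makes the case distinction in \<open>H'\<close> continuous.\<close>
  have G_eq_H: "G (y W) (cut t, x) = H t x"
    if "(t, x) \<in> NG ?\<Omega>" "W \<in> \<W>" "f x \<in> Y closure_of W" "\<And>W. t (n, W) = 0" for t x W
  proof -
    have c: "cut t = t" "t \<in> cube_on (S (y W))"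
      using cut_supp[OF that(1-3)] cut_eq[OF that(1) that(4)] by auto
    have "(t, x) \<in> NG (S (y W))"
      by (rule nerve_graph_shrink[OF that(1)]) (rule cube_on_supp[OF c(2)])
    then show ?thesis using sol(5)[OF that(2)] y[OF that(2)] that(3) c(1) by auto
  qed
  have G_eq_g: "G (y W) (cut t, x) = g x"
    if "(t, x) \<in> NG ?\<Omega>" "W \<in> \<W>" "f x \<in> Y closure_of W" "x \<in> A" for t x W
    by (rule sol(6)[OF that(2) cut_supp[OF that(1-3)] that(4)]) (use y[OF that(2)] that(3) in blast)
  have H'_Some: "W \<in> \<W> \<and> f x \<in> Y closure_of W \<and> (\<forall>W'. W' \<noteq> W \<longrightarrow> t (n, W') = 0) \<and> H' t x = G (y W) (cut t, x)"
    if "(t, x) \<in> NG ?\<Omega>" "t (n, W) \<noteq> 0" for t x W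
  proof -
    note t = nerve_graph_D[OF that(1)]
    have "W \<in> \<W>" using cube_on_supp[OF t(1) that(2)] level by auto
    moreover have "f x \<in> Y closure_of W" using t(3)[OF that(2)] by simp
    moreover have "t (n, W') = 0" if "W' \<noteq> W" for W' using t(4)[OF \<open>t (n, W) \<noteq> 0\<close>, of W'] that by blast
    moreover have "(SOME W. t (n, W) \<noteq> 0) = W"
      by (rule some_equality) (use t(4) that(2) in blast)+
    then have "H' t x = G (y W) (cut t, x)" using that(2) unfolding H'_def by auto
    ultimately show ?thesis by blast
  qed
  have H'_None: "H' t x = H t x" if "\<And>W. t (n, W) = 0" for t x
    using that by (simp add: H'_def)
  have "partial_system ?\<Omega> H'"
    unfolding partial_system_def
  proof (intro allI impI conjI)
    fix F assume F: "F \<subseteq> ?\<Omega>" "finite F"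
    let ?Z = "subtopology (param_prod X) (NG F)"
    have NGF: "NG F \<subseteq> NG ?\<Omega>" by (rule nerve_graph_mono[OF F(1)])
    show "H' t x = g x" if z: "(t, x) \<in> NG F" "x \<in> A" for t x
    proof (cases "\<exists>W. t (n, W) \<noteq> 0")
      case True
      then obtain W where "t (n, W) \<noteq> 0" ..
      with H'_Some[of t x W] have "W \<in> \<W>" "f x \<in> Y closure_of W" "H' t x = G (y W) (cut t, x)"
        using NGF z(1) by blast+
      with G_eq_g[of t x W] show ?thesis using NGF z by auto
    next
      case False
      then have *: "t (n, W) = 0" for W by auto
      \<comment> \<open>Without a vertex on level \<open>n\<close> the support lies in
        \<open>F \<inter> \<Omega>\<close>, where the old system governs.\<close>
      have "(t, x) \<in> NG (F \<inter> \<Omega>)"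
      proof (rule nerve_graph_shrink[OF z(1)])
        fix j assume "t j \<noteq> 0"
        have "j \<in> F" using cube_on_supp[OF nerve_graph_D(1)[OF z(1)] \<open>t j \<noteq> 0\<close>] .
        then show "j \<in> F \<inter> \<Omega>" using F(1) * \<open>t j \<noteq> 0\<close> by (cases j) auto
      qed
      then have "H t x = g x" by (rule partial_system_D(2)[OF H _ _ _ z(2), rotated 2]) (use F(2) in auto)
      moreover have "H' t x = H t x" by (rule H'_None) (rule *)
      ultimately show ?thesis by simp
    qed
    \<comment> \<open>Together with the \<open>C W\<close> for the finitely many \<open>W\<close> in
      \<open>?I\<close>, this gives a closed cover: \<open>C0\<close> allows no vertex of level
      \<open>n\<close>, \<open>C W\<close> at most the vertex \<open>W\<close>. On each piece
      \<open>H'\<close> follows a single formula, on \<open>C W\<close> even where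
      \<open>t (n, W) = 0\<close>.\<close>
    define C0 where "C0 = {z \<in> topspace ?Z. \<forall>j\<in>{n} \<times> UNIV. fst z j \<in> {0}}"
    define C where "C W = {z \<in> topspace ?Z. f (snd z) \<in> Y closure_of W \<and> (\<forall>j\<in>{n} \<times> (UNIV - {W}). fst z j \<in> {0})}" for W
    let ?I = "{W \<in> \<W>. (n, W) \<in> F}"
    have topZ: "topspace ?Z = NG F"
      using nerve_graph_subset[of Y X f F] by auto
    have C0_D: "(t, x) \<in> NG F" "t (n, W) = 0" if "(t, x) \<in> C0" for t x W
      using that unfolding C0_def topZ by auto
    have C_D: "(t, x) \<in> NG F" "f x \<in> Y closure_of W" "W' \<noteq> W \<Longrightarrow> t (n, W') = 0" if "(t, x) \<in> C W" for t x W W'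
      using that unfolding C_def topZ by auto
    have clC0: "closedin ?Z C0"
      unfolding C0_def by (intro closedin_Collect_Ball closedin_param_coord) simp
    have clC: "closedin ?Z (C W)" for W
      unfolding C_def
      by (intro closedin_Collect_conj closedin_Collect_Ball closedin_param_coord
          closedin_param_snd[OF contf] closedin_closure_of) simp
    have C0_NG: "C0 \<subseteq> NG (F \<inter> \<Omega>)"
    proof
      fix z assume z: "z \<in> C0"
      obtain t x where zz: "z = (t, x)" by (cases z)
      have z': "(t, x) \<in> NG F" using C0_D(1) z zz by simp
      have "(t, x) \<in> NG (F \<inter> \<Omega>)"
      proof (rule nerve_graph_shrink[OF z'])
        fix j assume "t j \<noteq> 0"
        have "j \<in> F" using cube_on_supp[OF nerve_graph_D(1)[OF z'] \<open>t j \<noteq> 0\<close>] .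
        then show "j \<in> F \<inter> \<Omega>" using F(1) C0_D(2)[of t x] z zz \<open>t j \<noteq> 0\<close> by (cases j) auto
      qed
      then show "z \<in> NG (F \<inter> \<Omega>)" using zz by simp
    qed
    have "continuous_map (subtopology (param_prod X) (NG (F \<inter> \<Omega>))) K (\<lambda>(t, x). H t x)"
      by (rule partial_system_D(1)[OF H]) (use F(2) in auto)
    from continuous_map_from_subtopology_mono[OF this C0_NG]
    have "continuous_map (subtopology (param_prod X) C0) K (\<lambda>(t, x). H' t x)"
    proof (rule continuous_map_eq)
      fix z assume "z \<in> topspace (subtopology (param_prod X) C0)"
      then have "z \<in> C0" by simp
      then show "(case z of (t, x) \<Rightarrow> H t x) = (case z of (t, x) \<Rightarrow> H' t x)"
        using C0_D(2) H'_None by (cases z) simp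
    qed
    then have cont0: "continuous_map (subtopology ?Z C0) K (\<lambda>(t, x). H' t x)"
      using closedin_subset[OF clC0] unfolding topZ by (simp add: subtopology_subtopology inf.absorb2)
    have contC: "continuous_map (subtopology ?Z (C W)) K (\<lambda>(t, x). H' t x)" if W: "W \<in> \<W>" for W
    proof -
      let ?ZC = "subtopology (param_prod X) (C W)"
      let ?D = "cube_on (S (y W)) \<times> {x \<in> topspace X. f x \<in> V (y W)}"
      have coord: "continuous_map ?ZC euclideanreal (\<lambda>z. cut (fst z) j)" for j
        by (cases "fst j < n") (simp_all add: cut_def continuous_map_param_coord)
      have "continuous_map ?ZC (subtopology (param_prod X) ?D) (\<lambda>z. (cut (fst z), snd z))"
        unfolding continuous_map_in_subtopology
      proof
        show "continuous_map ?ZC (param_prod X) (\<lambda>z. (cut (fst z), snd z))"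
          unfolding continuous_map_paired continuous_map_componentwise_UNIV
          by (intro conjI allI coord continuous_map_from_subtopology[OF continuous_map_snd])
        show "(\<lambda>z. (cut (fst z), snd z)) \<in> topspace ?ZC \<rightarrow> ?D"
        proof
          fix z assume "z \<in> topspace ?ZC"
          then have "z \<in> C W" by simp
          then obtain t x where zz: "z = (t, x)" "(t, x) \<in> C W" by (cases z) simp
          have "(t, x) \<in> NG ?\<Omega>" "f x \<in> Y closure_of W" using C_D(1,2)[OF zz(2)] NGF by blast+
          with cut_supp[OF this(1) W this(2)] nerve_graph_D(2)[OF this(1)] y[OF W]
          show "(cut (fst z), snd z) \<in> ?D" unfolding zz(1) by auto
        qed
      qed
      from continuous_map_compose[OF this sol(4)[OF W]]
      have "continuous_map ?ZC K (\<lambda>(t, x). H' t x)"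
      proof (rule continuous_map_eq)
        fix z assume "z \<in> topspace ?ZC"
        then have "z \<in> C W" by simp
        then obtain t x where zz: "z = (t, x)" "(t, x) \<in> C W" by (cases z) simp
        have tx: "(t, x) \<in> NG ?\<Omega>" "f x \<in> Y closure_of W" using C_D(1,2)[OF zz(2)] NGF by blast+
        have "G (y W) (cut t, x) = H' t x"
        proof (cases "t (n, W) = 0")
          case True
          then have 0: "t (n, W') = 0" for W' using C_D(3)[OF zz(2), of W'] by blast
          have "H' t x = H t x" by (rule H'_None) (rule 0)
          moreover have "G (y W) (cut t, x) = H t x" by (rule G_eq_H[OF tx(1) W tx(2)]) (rule 0)
          ultimately show ?thesis by simp
        next
          case False
          then show ?thesis using H'_Some[OF tx(1) False] by simp
        qed
        then show "(G (y W) \<circ> (\<lambda>z. (cut (fst z), snd z))) z = (case z of (t, x) \<Rightarrow> H' t x)"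
          unfolding zz(1) by simp
      qed
      then show ?thesis
        using closedin_subset[OF clC] unfolding topZ by (simp add: subtopology_subtopology inf.absorb2)
    qed
    show "continuous_map ?Z K (\<lambda>(t, x). H' t x)"
    proof (rule continuous_map_finite_closed_cover[where \<C> = "insert C0 (C ` ?I)"])
      have "Pair n ` ?I \<subseteq> F" by blast
      then have "finite (Pair n ` ?I)" using F(2) by (rule finite_subset)
      then have "finite ?I" by (rule finite_imageD) (simp add: inj_on_def)
      then show "finite (insert C0 (C ` ?I))" by simp
      show "closedin ?Z D \<and> continuous_map (subtopology ?Z D) K (\<lambda>(t, x). H' t x)"
        if "D \<in> insert C0 (C ` ?I)" for D
        using that clC0 clC cont0 contC by blast
      show "topspace ?Z \<subseteq> \<Union> (insert C0 (C ` ?I))"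
      proof
        fix z assume z: "z \<in> topspace ?Z"
        obtain t x where zz: "z = (t, x)" by (cases z)
        have tx: "(t, x) \<in> NG F" "(t, x) \<in> NG ?\<Omega>" using z NGF unfolding topZ zz by blast+
        show "z \<in> \<Union> (insert C0 (C ` ?I))"
        proof (cases "\<exists>W. t (n, W) \<noteq> 0")
          case True
          then obtain W where W: "t (n, W) \<noteq> 0" ..
          have "(n, W) \<in> F" using cube_on_supp[OF nerve_graph_D(1)[OF tx(1)] W] .
          moreover have "z \<in> C W" using H'_Some[OF tx(2) W] z unfolding C_def zz by simp
          ultimately show ?thesis using H'_Some[OF tx(2) W] by blast
        next
          case False
          then have "z \<in> C0" using z unfolding C0_def zz by simp
          then show ?thesis by blast
        qed
      qed
    qed
  qed
  moreover have "H' t x = H t x" if "(t, x) \<in> NG \<Omega>" for t x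
  proof (rule H'_None)
    show "t (n, W) = 0" for W
      by (rule cube_on_eq_0[OF nerve_graph_D(1)[OF that]]) (use level in auto)
  qed
  ultimately show ?thesis using that \<W> by blast
qed

text \<open>Dependent choice runs the step on every level. Each stage keeps the earlier values over
  the earlier nerve graph, so the stages have a common limit, and any finite \<open>F\<close>
  already lies in one stage.\<close>

lemma partial_system_exists:
  obtains \<Omega> H where "\<And>n. open_cover_of Y {W. (n, W) \<in> \<Omega>}" "partial_system \<Omega> H"
proof -
  \<comment> \<open>Stage \<open>n\<close> uses only levels below \<open>n\<close>, so the next step
    adds level \<open>n\<close> afresh.\<close>
  define P where "P n s \<longleftrightarrow> fst s \<subseteq> {..<n} \<times> UNIV \<and> index_locally_finite Y (fst s) \<and> partial_system (fst s) (snd s)"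
    for n :: nat and s :: "(nat \<times> 'b set) set \<times> ((nat \<times> 'b set \<Rightarrow> real) \<Rightarrow> 'a \<Rightarrow> 'k)"
  define Q where "Q n s s' \<longleftrightarrow> (\<exists>\<W>. open_cover_of Y \<W> \<and> fst s' = fst s \<union> {n} \<times> \<W>) \<and>
      (\<forall>t x. (t, x) \<in> NG (fst s) \<longrightarrow> snd s' t x = snd s t x)"
    for n :: nat and s s' :: "(nat \<times> 'b set) set \<times> ((nat \<times> 'b set \<Rightarrow> real) \<Rightarrow> 'a \<Rightarrow> 'k)"
  have "\<exists>s. \<forall>n. P n (s n) \<and> Q n (s n) (s (Suc n))"
  proof (rule dependent_nat_choice)
    \<comment> \<open>A nerve point has a coordinate equal to 1, hence a vertex. The nerve graph
      over no indices is therefore empty, and any function can start the recursion.\<close>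
    have empty: "NG {} = {}" using cube_on_supp unfolding nerve_graph_def by fastforce
    have "partial_system {} (\<lambda>_ _. undefined)"
      unfolding partial_system_def by (simp add: empty)
    moreover have "index_locally_finite Y {}" unfolding index_locally_finite_def by auto
    ultimately have "P 0 ({}, \<lambda>_ _. undefined)" unfolding P_def by simp
    then show "\<exists>s. P 0 s" by blast
  next
    fix s n assume "P n s"
    then have s: "fst s \<subseteq> {..<n} \<times> UNIV" "index_locally_finite Y (fst s)" "partial_system (fst s) (snd s)"
      unfolding P_def by auto
    obtain \<W> H' where W: "open_cover_of Y \<W>" "locally_finite_in Y \<W>"
      "partial_system (fst s \<union> {n} \<times> \<W>) H'" "\<forall>t x. (t, x) \<in> NG (fst s) \<longrightarrow> H' t x = snd s t x"
      by (rule partial_system_step[OF s(2,3,1)]) (rule that)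
    have "fst s \<union> {n} \<times> \<W> \<subseteq> {..<Suc n} \<times> UNIV" using s(1) by auto
    then have "P (Suc n) (fst s \<union> {n} \<times> \<W>, H')"
      unfolding P_def using index_locally_finite_Un[OF s(2) W(2)] W(3) by simp
    moreover have "Q n s (fst s \<union> {n} \<times> \<W>, H')"
      unfolding Q_def fst_conv snd_conv using W(1,4) by blast
    ultimately show "\<exists>s'. P (Suc n) s' \<and> Q n s s'" by blast
  qed
  then obtain s where P: "\<And>n. P n (s n)" and Q: "\<And>n. Q n (s n) (s (Suc n))" by blast
  define \<Omega> where "\<Omega> = (\<Union>n. fst (s n))"
  \<comment> \<open>The first stage whose nerve graph contains \<open>(t, x)\<close> decides; by
    \<open>stable\<close> every later stage gives the same value.\<close>
  define H where "H t x = snd (s (LEAST n. (t, x) \<in> NG (fst (s n)))) t x" for t x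
  have mono: "fst (s m) \<subseteq> fst (s n)" if "m \<le> n" for m n
    using lift_Suc_mono_le[of "\<lambda>n. fst (s n)", OF _ that] Q unfolding Q_def by blast
  have stable: "snd (s n) t x = snd (s m) t x" if "m \<le> n" "(t, x) \<in> NG (fst (s m))" for m n t x
    using that(1)
  proof (induction n rule: dec_induct)
    case (step n)
    have "(t, x) \<in> NG (fst (s n))" using nerve_graph_mono[OF mono[OF step(1)]] that(2) by blast
    then show ?case using Q[of n] step(3) unfolding Q_def by simp
  qed simp
  have H_eq: "H t x = snd (s n) t x" if "(t, x) \<in> NG (fst (s n))" for n t x
    unfolding H_def
    by (rule stable[symmetric, OF Least_le[of "\<lambda>n. (t, x) \<in> NG (fst (s n))", OF that]
          LeastI[of "\<lambda>n. (t, x) \<in> NG (fst (s n))", OF that]])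
  show ?thesis
  proof (rule that)
    fix n
    obtain \<W> where W: "open_cover_of Y \<W>" "fst (s (Suc n)) = fst (s n) \<union> {n} \<times> \<W>"
      using Q[of n] unfolding Q_def by blast
    have lev: "k < m" if "(k, W) \<in> fst (s m)" for k W m using P[of m] that unfolding P_def by blast
    \<comment> \<open>Level \<open>n\<close> is filled in passing from stage \<open>n\<close> to
      stage \<open>Suc n\<close>; earlier stages do not reach it and later ones leave it
      alone.\<close>
    have "(n, W) \<in> \<Omega> \<longleftrightarrow> W \<in> \<W>" for W
    proof
      assume "W \<in> \<W>"
      then have "(n, W) \<in> fst (s (Suc n))" using W(2) by simp
      then show "(n, W) \<in> \<Omega>" unfolding \<Omega>_def by blast
    next
      assume "(n, W) \<in> \<Omega>"
      then obtain m where m: "(n, W) \<in> fst (s m)" unfolding \<Omega>_def by blast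
      have "(n, W) \<in> fst (s (Suc n))"
      proof (rule ccontr)
        assume not: "(n, W) \<notin> fst (s (Suc n))"
        have "(n, W) \<notin> fst (s k)" if "Suc n \<le> k" for k
          using that
        proof (induction k rule: dec_induct)
          case (step k)
          obtain \<V> where "fst (s (Suc k)) = fst (s k) \<union> {k} \<times> \<V>" using Q[of k] unfolding Q_def by blast
          then show ?case using step by auto
        qed (rule not)
        with m lev[OF m] show False by simp
      qed
      then show "W \<in> \<W>" using W(2) lev by auto
    qed
    then show "open_cover_of Y {W. (n, W) \<in> \<Omega>}" using W(1) by simp
  next
    show "partial_system \<Omega> H"
      unfolding partial_system_def
    proof (intro allI impI)
      fix F assume F: "F \<subseteq> \<Omega>" "finite F"
      have "\<exists>n. F \<subseteq> fst (s n)" using F(2,1)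
      proof (induction F)
        case (insert j F)
        then obtain n where n: "F \<subseteq> fst (s n)" by blast
        obtain m where m: "j \<in> fst (s m)" using insert.prems unfolding \<Omega>_def by blast
        have "insert j F \<subseteq> fst (s (max m n))" using n m mono[of m "max m n"] mono[of n "max m n"] by auto
        then show ?case ..
      qed simp
      then obtain n where n: "F \<subseteq> fst (s n)" ..
      have Pn: "partial_system (fst (s n)) (snd (s n))" using P[of n] unfolding P_def by simp
      have eq: "snd (s n) t x = H t x" if "(t, x) \<in> NG F" for t x
        using H_eq[OF subsetD[OF nerve_graph_mono[OF n] that]] by simp
      have "continuous_map (subtopology (param_prod X) (NG F)) K (\<lambda>(t, x). H t x)"
      proof (rule continuous_map_eq[OF partial_system_D(1)[OF Pn n F(2)]])
        fix z assume "z \<in> topspace (subtopology (param_prod X) (NG F))"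
        then show "(case z of (t, x) \<Rightarrow> snd (s n) t x) = (case z of (t, x) \<Rightarrow> H t x)"
          using eq by (cases z) simp
      qed
      moreover have "H t x = g x" if "(t, x) \<in> NG F" "x \<in> A" for t x
        using partial_system_D(2)[OF Pn n F(2) that] eq[OF that(1)] by simp
      ultimately show "continuous_map (subtopology (param_prod X) (NG F)) K (\<lambda>(t, x). H t x) \<and>
          (\<forall>t x. (t, x) \<in> NG F \<longrightarrow> x \<in> A \<longrightarrow> H t x = g x)" by blast
    qed
  qed
qed

subsection \<open>The map into the nerve\<close>

text \<open>Local control of \<open>t\<close>: finitely many vertices and continuous coordinates,
  which is the form in which a \<open>partial_system\<close> can be composed with it.\<close>

definition nerve_chart where
  "nerve_chart \<Omega> t V F \<longleftrightarrow> openin Y V \<and> finite F \<and> F \<subseteq> \<Omega> \<and>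
     (\<forall>j. continuous_map (subtopology Y V) euclideanreal (\<lambda>z. t z j)) \<and>
     (\<forall>x\<in>topspace X. f x \<in> V \<longrightarrow> (t (f x), x) \<in> NG F)"

lemma nerve_chart_D:
  assumes "nerve_chart \<Omega> t V F"
  shows "openin Y V" "finite F" "F \<subseteq> \<Omega>"
    and "\<And>j. continuous_map (subtopology Y V) euclideanreal (\<lambda>z. t z j)"
    and "\<And>x. x \<in> topspace X \<Longrightarrow> f x \<in> V \<Longrightarrow> (t (f x), x) \<in> NG F"
  using assms unfolding nerve_chart_def by (simp_all del: split_paired_All)

text \<open>Members of one \<open>\<gamma> n\<close> are disjoint, so the weights below have at most one nonzero
  coordinate on each level.\<close>

lemma nerve_map_exists:
  assumes "C_space Y" and \<Omega>: "\<And>n. open_cover_of Y {W. (n, W) \<in> \<Omega>}"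
  shows "\<exists>t. \<forall>x\<in>topspace X. \<exists>V F. f x \<in> V \<and> nerve_chart \<Omega> t V F"
proof -
  obtain \<gamma> where \<gamma>: "\<And>n. \<forall>U\<in>\<gamma> n. openin Y U" "\<And>n. pairwise disjnt (\<gamma> n)"
      "\<And>n. refines (\<gamma> n) {W. (n, W) \<in> \<Omega>}" "topspace Y \<subseteq> (\<Union>n. \<Union>(\<gamma> n))"
    using assms(1)[unfolded C_space_def, rule_format, of "\<lambda>n. {W. (n, W) \<in> \<Omega>}"] \<Omega> by blast
  have "\<forall>U\<in>\<gamma> n. \<exists>W. (n, W) \<in> \<Omega> \<and> U \<subseteq> W" for n using \<gamma>(3)[of n] unfolding refines_def by blast
  then obtain \<sigma> where \<sigma>: "\<And>n U. U \<in> \<gamma> n \<Longrightarrow> (n, \<sigma> n U) \<in> \<Omega> \<and> U \<subseteq> \<sigma> n U" by metis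
  have op: "openin Y (\<Union>(\<gamma> n))" for n using \<gamma>(1) by (simp add: openin_Union)
  show ?thesis
  proof (rule countable_open_cover_functions[OF regY paraY, of "\<lambda>n. \<Union>(\<gamma> n)", OF op \<gamma>(4)])
    fix p :: "nat \<Rightarrow> 'b \<Rightarrow> real" and D
    assume p: "\<And>n. continuous_map Y euclideanreal (p n)" "\<And>n z. 0 \<le> p n z \<and> p n z \<le> 1"
      and D: "\<And>n. closedin Y (D n)" "\<And>n. D n \<subseteq> \<Union>(\<gamma> n)" "\<And>n z. z \<in> topspace Y \<Longrightarrow> p n z \<noteq> 0 \<Longrightarrow> z \<in> D n"
      and p1: "\<And>z. z \<in> topspace Y \<Longrightarrow> \<exists>n. p n z = 1"
      and pfin: "\<And>z. z \<in> topspace Y \<Longrightarrow> \<exists>V m. openin Y V \<and> z \<in> V \<and> (\<forall>n w. w \<in> V \<longrightarrow> p n w \<noteq> 0 \<longrightarrow> n \<le> m)"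
    have unique: "U = U'" if "U \<in> \<gamma> n" "U' \<in> \<gamma> n" "z \<in> U" "z \<in> U'" for n U U' z
      using \<gamma>(2)[of n] that unfolding pairwise_def disjnt_def by blast
    \<comment> \<open>The whole weight \<open>p n z\<close> goes to one vertex of level
      \<open>n\<close>, namely \<open>\<sigma> n U\<close> for the only \<open>U\<close> in
      \<open>\<gamma> n\<close> containing \<open>z\<close>. Different \<open>U\<close> may share a
      vertex.\<close>
    define t where "t z j = (if \<exists>U\<in>\<gamma> (fst j). z \<in> U \<and> \<sigma> (fst j) U = snd j then p (fst j) z else 0)" for z j
    have t01: "0 \<le> t z j" "t z j \<le> 1" for z j using p(2) by (auto simp: t_def)
    have t_nz: "\<exists>U\<in>\<gamma> (fst j). z \<in> U \<and> \<sigma> (fst j) U = snd j" if "t z j \<noteq> 0" for z j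
      using that unfolding t_def by presburger
    show ?thesis
    proof (intro exI[of _ t] ballI)
      fix x assume x: "x \<in> topspace X"
      let ?y = "f x"
      have y: "?y \<in> topspace Y" using x contf by (auto simp: continuous_map_def)
      obtain V0 m where V0: "openin Y V0" "?y \<in> V0" "\<And>n w. w \<in> V0 \<Longrightarrow> p n w \<noteq> 0 \<Longrightarrow> n \<le> m"
        using pfin[OF y] by blast
      \<comment> \<open>Near \<open>f x\<close>, level \<open>n\<close> is either confined to a
        single member of \<open>\<gamma> n\<close> or, off the closed set \<open>D n\<close>,
        carries no weight.\<close>
      have "\<exists>N. openin Y N \<and> ?y \<in> N \<and> (if ?y \<in> D n then N \<in> \<gamma> n else N \<inter> D n = {})" for n
      proof (cases "?y \<in> D n")
        case True
        then obtain U where "U \<in> \<gamma> n" "?y \<in> U" using D(2) by blast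
        then show ?thesis using \<gamma>(1) True by auto
      next
        case False
        then show ?thesis using D(1)[of n] y by (intro exI[of _ "topspace Y - D n"]) auto
      qed
      then obtain N where N: "\<And>n. openin Y (N n)" "\<And>n. ?y \<in> N n"
        "\<And>n. if ?y \<in> D n then N n \<in> \<gamma> n else N n \<inter> D n = {}" by metis
      \<comment> \<open>Only levels up to \<open>m\<close> carry weight on \<open>V0\<close>, so a
        finite intersection of the \<open>N n\<close> suffices and \<open>V\<close> is open.\<close>
      define V where "V = V0 \<inter> (\<Inter>n\<in>{..m}. N n)"
      define F where "F = (\<lambda>n. (n, \<sigma> n (N n))) ` {n. n \<le> m \<and> ?y \<in> D n}"
      have V: "openin Y V" "?y \<in> V"
        using V0 N unfolding V_def by (auto intro!: openin_Int openin_INT2)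
      have VY: "V \<subseteq> topspace Y" using openin_subset[OF V(1)] .
      have F: "finite F" "F \<subseteq> \<Omega>"
      proof -
        show "finite F" unfolding F_def by simp
        have "(n, \<sigma> n (N n)) \<in> \<Omega>" if "?y \<in> D n" for n using \<sigma>[of "N n" n] N(3)[of n] that by simp
        then show "F \<subseteq> \<Omega>" unfolding F_def by blast
      qed
      \<comment> \<open>Nonzero weight puts \<open>z\<close> into \<open>D n\<close>, which rules
        out \<open>N n \<inter> D n = {}\<close>. So \<open>N n\<close> is a member of
        \<open>\<gamma> n\<close> containing \<open>z\<close>, and by disjointness the one that
        determines the coordinate.\<close>
      have t_eq: "t z j = (if j \<in> F then p (fst j) z else 0)" if z: "z \<in> V" for z j
      proof (cases "p (fst j) z = 0")
        case True
        then show ?thesis by (simp add: t_def)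
      next
        case False
        let ?n = "fst j"
        have "z \<in> V0" using z by (simp add: V_def)
        then have n: "?n \<le> m" using V0(3) False by blast
        then have zN: "z \<in> N ?n" using z by (simp add: V_def)
        have "z \<in> D ?n" using D(3)[OF _ False] z VY by blast
        then have yD: "?y \<in> D ?n" using N(3)[of ?n] zN by (auto split: if_splits)
        then have N\<gamma>: "N ?n \<in> \<gamma> ?n" using N(3)[of ?n] by simp
        have "(\<exists>U\<in>\<gamma> ?n. z \<in> U \<and> \<sigma> ?n U = snd j) \<longleftrightarrow> \<sigma> ?n (N ?n) = snd j"
          using unique[OF N\<gamma> _ zN] N\<gamma> zN by metis
        also have "\<dots> \<longleftrightarrow> j \<in> F"
          using n yD unfolding F_def by (cases j) auto
        finally show ?thesis by (simp add: t_def)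
      qed
      have "continuous_map (subtopology Y V) euclideanreal (\<lambda>z. t z j)" for j
      proof (rule continuous_map_eq)
        show "continuous_map (subtopology Y V) euclideanreal (\<lambda>z. if j \<in> F then p (fst j) z else 0)"
          by (cases "j \<in> F") (simp_all add: continuous_map_from_subtopology p(1))
      qed (simp add: t_eq)
      moreover have "(t (f x'), x') \<in> NG F" if x': "x' \<in> topspace X" "f x' \<in> V" for x'
      proof -
        have z: "f x' \<in> topspace Y" using x'(2) VY by blast
        have "t (f x') \<in> cube_on F" unfolding cube_on_iff by (intro conjI allI impI t01) (simp add: t_eq[OF x'(2)])
        moreover have "\<exists>j. t (f x') j = 1"
        proof -
          obtain n where n: "p n (f x') = 1" using p1[OF z] by blast
          then obtain U where "U \<in> \<gamma> n" "f x' \<in> U" using D(2)[of n] D(3)[OF z, of n] by auto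
          then have "t (f x') (n, \<sigma> n U) = 1" using n by (auto simp: t_def)
          then show ?thesis ..
        qed
        moreover have "W = W'" if nz: "t (f x') (n, W) \<noteq> 0" "t (f x') (n, W') \<noteq> 0" for n W W'
          using t_nz[OF nz(1)] t_nz[OF nz(2)] unique unfolding fst_conv snd_conv by blast
        moreover have "f x' \<in> Y closure_of W" if nz: "t (f x') (n, W) \<noteq> 0" for n W
        proof -
          obtain U where U: "U \<in> \<gamma> n" "f x' \<in> U" "\<sigma> n U = W" using t_nz[OF nz] by auto
          have "(n, W) \<in> \<Omega>" "f x' \<in> W" using \<sigma>[OF U(1)] U by auto
          then have "W \<subseteq> topspace Y" using \<Omega>[of n] by (auto simp: open_cover_of_def)
          then show ?thesis using closure_of_subset \<open>f x' \<in> W\<close> by blast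
        qed
        ultimately show ?thesis using x'(1) unfolding nerve_graph_def by blast
      qed
      ultimately have "nerve_chart \<Omega> t V F"
        using V(1) F unfolding nerve_chart_def by (intro conjI allI ballI impI)
      with V(2) show "\<exists>V F. f x \<in> V \<and> nerve_chart \<Omega> t V F" by blast
    qed
  qed
qed

text \<open>Over a chart the pairs \<open>(t (f x), x)\<close> vary continuously inside one
  \<open>NG F\<close> with \<open>F\<close> finite, where \<open>H\<close> is continuous. The
  preimages of the charts form an open cover of \<open>X\<close>, so continuity is checked
  locally.\<close>

lemma extension_exists:
  assumes "C_space Y"
  shows "\<exists>h. continuous_map X K h \<and> (\<forall>x\<in>A. h x = g x)"
proof -
  obtain \<Omega> H where \<Omega>: "\<And>n. open_cover_of Y {W. (n, W) \<in> \<Omega>}" and H: "partial_system \<Omega> H"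
    using partial_system_exists by blast
  obtain t where "\<forall>x\<in>topspace X. \<exists>V F. f x \<in> V \<and> nerve_chart \<Omega> t V F"
    using nerve_map_exists[OF assms \<Omega>] ..
  then obtain V F where V: "\<And>x. x \<in> topspace X \<Longrightarrow> f x \<in> V x"
    and VF: "\<And>x. x \<in> topspace X \<Longrightarrow> nerve_chart \<Omega> t (V x) (F x)"
    by metis
  note chart = nerve_chart_D[OF VF]
  let ?N = "\<lambda>x. {x' \<in> topspace X. f x' \<in> V x}"
  let ?h = "\<lambda>x. H (t (f x)) x"
  have "continuous_map X K ?h"
  proof (rule pasting_lemma[where I = "topspace X" and T = ?N and f = "\<lambda>_. ?h"])
    fix x assume x: "x \<in> topspace X"
    show "openin X (?N x)" by (rule openin_continuous_map_preimage[OF contf chart(1)[OF x]])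
    have fN: "continuous_map (subtopology X (?N x)) (subtopology Y (V x)) f"
      using contf by (auto simp: continuous_map_in_subtopology continuous_map_from_subtopology)
    have coord: "continuous_map (subtopology X (?N x)) euclideanreal (\<lambda>x'. t (f x') j)" for j
      using continuous_map_compose[OF fN chart(4)[OF x, of j]] by (simp add: o_def)
    have "continuous_map (subtopology X (?N x)) (subtopology (param_prod X) (NG (F x))) (\<lambda>x'. (t (f x'), x'))"
      unfolding continuous_map_in_subtopology
    proof
      show "continuous_map (subtopology X (?N x)) (param_prod X) (\<lambda>x'. (t (f x'), x'))"
        unfolding continuous_map_paired continuous_map_componentwise_UNIV
        using coord continuous_map_from_subtopology[OF continuous_map_id] by (simp add: id_def)
    qed (use chart(5)[OF x] in auto)
    from continuous_map_compose[OF this partial_system_D(1)[OF H chart(3,2)[OF x]]]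
    show "continuous_map (subtopology X (?N x)) K ?h" by (simp add: o_def)
  qed (use V in auto)
  moreover have "?h x = g x" if "x \<in> A" for x
  proof -
    have x: "x \<in> topspace X" using closedin_subset[OF closedA] that by blast
    show ?thesis using partial_system_D(2)[OF H chart(3,2)[OF x] chart(5)[OF x x V[OF x]] that] .
  qed
  ultimately show ?thesis by blast
qed

end

theorem theorem3p2:
  fixes X :: "'a topology" and Y :: "'b topology" and K :: "'k topology" and f :: "'a \<Rightarrow> 'b"
  assumes "tychonoff_space X" and "tychonoff_space Y" and "tychonoff_space K"
    and "continuous_map X Y f" and "closed_map X Y f" and "f ` topspace X = topspace Y"
    and "k_space X"
    and "paracompact_space Y" and "C_space Y"
    and "\<And>m y. m \<ge> 1 \<Longrightarrow> y \<in> topspace Y \<Longrightarrow>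
           in_ANE K (prod_topology (cube m) X) \<and>
           in_AE K (prod_topology (cube m) (subtopology X {x \<in> topspace X. f x = y}))"
  shows "in_AE K X"
\<comment> \<open>The \<open>ANE\<close> hypothesis is available only along with a point of
  \<open>Y\<close>; a nonempty \<open>X\<close> yields one through \<open>f\<close>. On an empty
  \<open>X\<close> every function is continuous.\<close>
proof (cases "topspace X = {}")
  case True
  then have "continuous_map X K h" for h :: "'a \<Rightarrow> 'k" by (simp add: continuous_map_on_empty)
  then show ?thesis unfolding in_AE_def by blast
next
  case False
  then obtain y0 where y0: "y0 \<in> topspace Y" using assms(6) by blast
  show ?thesis
    unfolding in_AE_def
  proof (intro allI impI, elim conjE)
    fix A g assume A: "closedin X A" and g: "continuous_map (subtopology X A) K g"
    interpret fibrewise_extension X Y K f A g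
    proof
      show "regular_space Y" "t1_space Y"
        using assms(2) by (auto simp: tychonoff_space_def completely_regular_imp_regular_space)
      show "in_ANE K (prod_topology (subtopology (powertop_real UNIV) (cube_on F)) X)"
        if "finite F" for F :: "(nat \<times> 'b set) set"
        using in_ANE_cube_on[OF that] assms(10) y0 by blast
      show "in_AE K (prod_topology (subtopology (powertop_real UNIV) (cube_on F))
          (subtopology X {x \<in> topspace X. f x = y}))"
        if "finite F" "y \<in> topspace Y" for F :: "(nat \<times> 'b set) set" and y
        using in_AE_cube_on[OF that(1)] assms(10) that(2) by blast
    qed (use assms A g in auto)
    show "\<exists>h. continuous_map X K h \<and> (\<forall>x\<in>A. h x = g x)"
      by (rule extension_exists[OF assms(9)])
  qed
qed

end
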